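(* Fix $\alpha_0\in(0,1)$. For the problem of testing $$H_0:\ X_i\overset{\text{i.i.d.}}{\sim}\mathrm{Exp}(2),\qquad H_1^{(n)}:\ X_i\overset{\text{i.i.d.}}{\sim}(1-\varepsilon_n)\,\mathrm{Exp}(2)+\varepsilon_n\,\chi_2^2(\delta_n),\qquad 1\le i\le n,$$ with $\varepsilon_n=n^{-\beta}$ and $\delta_n=2r\log(n)$, the detection boundary $\rho_{\mathrm{HC,Exp}}$ of the higher criticism test and the intrinsic detection boundary $\rho^*_{\mathrm{Exp}}$ are both equal to $$\rho_{\mathrm{HC,Exp}}(\beta)=\rho^*_{\mathrm{Exp}}(\beta)=\begin{cases}\beta-\tfrac12,& \tfrac12<\beta\le\tfrac34,\\ (1-\sqrt{1-\beta})^2,& \tfrac34<\beta<1.\end{cases}$$ That is, writing $\rho(\beta)$ for the right-hand side, for all $\beta\in(\tfrac12,1)$ and $r\in(0,1)$: (1) if $r<\rho(\beta)$, then $H_0$ and $H_1^{(n)}$ merge asymptotically, and if $r>\rho(\beta)$, then $H_0$ and $H_1^{(n)}$ separate asymptotically; (2) for the tests rejecting $H_0$ when $\mathrm{HC}_n^*>h(n,\alpha_n)$, with levels $\alpha_n\to0$ slowly enough, if $r>\rho(\beta)$ then $P_{H_1^{(n)}}\{\mathrm{HC}_n^*>h(n,\alpha_n)\}\to1$, and if $r<\rho(\beta)$ then $P_{H_1^{(n)}}\{\mathrm{HC}_n^*>h(n,\alpha_n)\}\to0$, as $n\to\infty$.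
   Context: $\mathrm{Exp}(2)$ is the exponential distribution with mean $2$; $\chi_2^2(\delta)$ is the noncentral chi-squared distribution with $2$ degrees of freedom and noncentrality parameter $\delta$ (the law of $(z_1+\sqrt\delta)^2+z_2^2$ with $z_1,z_2$ i.i.d. $N(0,1)$). $H_0$ and $H_1^{(n)}$ merge asymptotically if the sum of Type I and Type II errors of the likelihood ratio test (equivalently, the minimum of this sum over all tests) tends to $1$ as $n\to\infty$; they separate asymptotically if it tends to $0$. The $p$-values are $p_i=\mathrm{Prob}\{\mathrm{Exp}(2)>X_i\}$, sorted as $p_{(1)}\le\dots\le p_{(n)}$. For a fixed $\alpha_0\in(0,1)$ the higher criticism statistic is $$\mathrm{HC}_n^*=\max_{1\le i\le \alpha_0 n}\ \frac{\sqrt n\,[\,i/n-p_{(i)}\,]}{\sqrt{p_{(i)}(1-p_{(i)})}} .$$ $h(n,\alpha)$ denotes a critical value of the level-$\alpha$ test, so that $P_{H_0}\{\mathrm{HC}_n^*>h(n,\alpha)\}\le\alpha$. One says that $\alpha_n\to0$ slowly enough if $\alpha_n\to 0$ and $h(n,\alpha_n)=\sqrt{2\log\log(n)}\,(1+o(1))$. *)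

theory Defs
  imports "HOL-Probability.Probability" "HOL-Library.Landau_Symbols"
begin

section \<open>The laws of a single observation\<close>

text \<open>The exponential law with \<^emph>\<open>mean\<close> 2; the parameter of \<^const>\<open>exponential_density\<close> is the rate.\<close>

definition Exp2 :: "real measure" where
  "Exp2 = density lborel (exponential_density (1 / 2))"

definition std_normal :: "real measure" where
  "std_normal = density lborel std_normal_density"

definition ncchisq2 :: "real \<Rightarrow> real measure" where
  "ncchisq2 d = distr (std_normal \<Otimes>\<^sub>M std_normal) borel (\<lambda>(z1, z2). (z1 + sqrt d)\<^sup>2 + z2\<^sup>2)"

definition mixture :: "real \<Rightarrow> 'a measure \<Rightarrow> 'a measure \<Rightarrow> 'a measure" where
  "mixture e M N = measure_of (space M) (sets M)
     (\<lambda>A. ennreal (1 - e) * emeasure M A + ennreal e * emeasure N A)"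

lemma prob_space_Exp2: "prob_space Exp2"
  unfolding Exp2_def by (rule prob_space_exponential_density) simp

lemma prob_space_std_normal: "prob_space std_normal"
  unfolding std_normal_def by (rule prob_space_normal_density) simp

lemma prob_space_ncchisq2: "prob_space (ncchisq2 d)"
proof -
  interpret N: prob_space std_normal by (rule prob_space_std_normal)
  interpret NN: pair_prob_space std_normal std_normal ..
  have [measurable_cong]: "sets std_normal = sets borel"
    by (simp add: std_normal_def)
  show ?thesis
    unfolding ncchisq2_def by (rule NN.prob_space_distr) measurable
qed

lemma sets_Exp2 [simp, measurable_cong]: "sets Exp2 = sets borel"
  by (simp add: Exp2_def)

lemma sets_ncchisq2 [simp, measurable_cong]: "sets (ncchisq2 d) = sets borel"
  by (simp add: ncchisq2_def)

lemma space_mixture [simp]: "space (mixture e M N) = space M"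
  by (simp add: mixture_def)

lemma sets_mixture [simp, measurable_cong]: "sets (mixture e M N) = sets M"
  by (simp add: mixture_def)

lemma emeasure_mixture:
  assumes "sets N = sets M" "A \<in> sets M"
  shows "emeasure (mixture e M N) A = ennreal (1 - e) * emeasure M A + ennreal e * emeasure N A"
proof (rule emeasure_measure_of[OF mixture_def])
  show "sets M \<subseteq> Pow (space M)"
    by (rule sets.space_closed)
  show "A \<in> sets (mixture e M N)"
    using assms by simp
  show "positive (sets (mixture e M N))
     (\<lambda>A. ennreal (1 - e) * emeasure M A + ennreal e * emeasure N A)"
    by (simp add: positive_def)
  show "countably_additive (sets (mixture e M N))
     (\<lambda>A. ennreal (1 - e) * emeasure M A + ennreal e * emeasure N A)"
    unfolding countably_additive_def
    using assms by (simp add: suminf_add[symmetric] suminf_emeasure)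
qed

lemma prob_space_mixture:
  assumes "prob_space M" "prob_space N" "sets N = sets M" "0 \<le> e" "e \<le> 1"
  shows "prob_space (mixture e M N)"
proof
  have "space N = space M"
    using assms(3) by (rule sets_eq_imp_space_eq)
  then have "emeasure (mixture e M N) (space M) = ennreal (1 - e) + ennreal e"
    using assms prob_space.emeasure_space_1[of M] prob_space.emeasure_space_1[of N]
    by (simp add: emeasure_mixture)
  also have "\<dots> = 1"
    using assms by (simp flip: ennreal_plus)
  finally show "emeasure (mixture e M N) (space (mixture e M N)) = 1"
    by simp
qed


section \<open>The testing problem\<close>

text \<open>Joint laws of \<open>(X\<^sub>1, \<dots>, X\<^sub>n)\<close>, on functions on \<open>{1..n}\<close>.\<close>

definition H0 :: "nat \<Rightarrow> (nat \<Rightarrow> real) measure" where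
  "H0 n = PiM {1..n} (\<lambda>_. Exp2)"

definition H1 :: "real \<Rightarrow> real \<Rightarrow> nat \<Rightarrow> (nat \<Rightarrow> real) measure" where
  "H1 \<beta> r n = PiM {1..n}
     (\<lambda>_. mixture (real n powr - \<beta>) Exp2 (ncchisq2 (2 * r * ln (real n))))"

text \<open>Sum of the Type I and Type II errors of the likelihood ratio test of \<open>P\<close> against \<open>Q\<close>,
  rejecting \<open>P\<close> when the likelihood ratio exceeds 1. This is the cut-off for which the sum of errors
  is minimal among all tests (\<open>lrt_error_minimal\<close> below). The Radon-Nikodym derivative
  is the likelihood ratio only if \<open>Q\<close> is absolutely continuous with respect to \<open>P\<close>, as is
  the case for \<^term>\<open>H1 \<beta> r n\<close> and \<^term>\<open>H0 n\<close>.\<close>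

definition lrt_error :: "'a measure \<Rightarrow> 'a measure \<Rightarrow> real" where
  "lrt_error P Q =
     measure P {x \<in> space P. RN_deriv P Q x > 1} + measure Q {x \<in> space Q. RN_deriv P Q x \<le> 1}"

lemma lrt_error_minimal:
  assumes "prob_space P" "prob_space Q" "sets Q = sets P" "absolutely_continuous P Q" "A \<in> sets P"
  shows "lrt_error P Q \<le> measure P A + measure Q (space Q - A)"
proof -
  interpret P: prob_space P by fact
  interpret Q: prob_space Q by fact
  have sp: "space Q = space P"
    using assms(3) by (rule sets_eq_imp_space_eq)
  define L where "L = RN_deriv P Q"
  have L [measurable]: "L \<in> borel_measurable P"
    by (simp add: L_def)
  have Q: "emeasure Q B = (\<integral>\<^sup>+x. L x * indicator B x \<partial>P)" if "B \<in> sets P" for B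
    using P.density_RN_deriv[OF assms(4,3)] emeasure_density[OF L that]
    by (simp add: L_def)
  define R where "R = {x \<in> space P. L x > 1}"
  have R [measurable]: "R \<in> sets P" and A [measurable]: "A \<in> sets P"
    using assms(5) by (auto simp: R_def)
  have sum: "emeasure P B + emeasure Q (space P - B) =
      (\<integral>\<^sup>+x. indicator B x + L x * indicator (space P - B) x \<partial>P)" if [measurable]: "B \<in> sets P" for B
    by (subst nn_integral_add) (auto simp: Q)
  have "emeasure P R + emeasure Q (space P - R) \<le> emeasure P A + emeasure Q (space P - A)"
    unfolding sum[OF R] sum[OF A]
    by (rule nn_integral_mono) (auto simp: R_def indicator_def not_less)
  then have "ennreal (measure P R + measure Q (space P - R))
      \<le> ennreal (measure P A + measure Q (space P - A))"
    by (simp add: P.emeasure_eq_measure Q.emeasure_eq_measure)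
  then have "measure P R + measure Q (space P - R) \<le> measure P A + measure Q (space P - A)"
    by (subst (asm) ennreal_le_iff) simp_all
  moreover have "space P - R = {x \<in> space Q. RN_deriv P Q x \<le> 1}"
    by (auto simp: R_def L_def sp)
  ultimately show ?thesis
    by (simp add: lrt_error_def R_def L_def sp)
qed

definition merge_asymptotically :: "(nat \<Rightarrow> 'a measure) \<Rightarrow> (nat \<Rightarrow> 'a measure) \<Rightarrow> bool" where
  "merge_asymptotically P Q \<longleftrightarrow> (\<lambda>n. lrt_error (P n) (Q n)) \<longlonglongrightarrow> 1"

definition separate_asymptotically :: "(nat \<Rightarrow> 'a measure) \<Rightarrow> (nat \<Rightarrow> 'a measure) \<Rightarrow> bool" where
  "separate_asymptotically P Q \<longleftrightarrow> (\<lambda>n. lrt_error (P n) (Q n)) \<longlonglongrightarrow> 0"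


section \<open>The higher criticism test\<close>

definition p_value :: "real \<Rightarrow> real" where
  "p_value x = measure Exp2 {x<..}"

definition sorted_p_value :: "nat \<Rightarrow> (nat \<Rightarrow> real) \<Rightarrow> nat \<Rightarrow> real" where
  "sorted_p_value n X i = sort (map (\<lambda>j. p_value (X j)) [1..<Suc n]) ! (i - 1)"

text \<open>The maximum is over a nonempty set only if \<open>1 \<le> \<alpha>0 * n\<close>; the value for the finitely many
  other \<open>n\<close> is arbitrary.\<close>

definition HC :: "real \<Rightarrow> nat \<Rightarrow> (nat \<Rightarrow> real) \<Rightarrow> real" where
  "HC \<alpha>0 n X =
     Max ((\<lambda>i. sqrt (real n) * (real i / real n - sorted_p_value n X i)
                / sqrt (sorted_p_value n X i * (1 - sorted_p_value n X i)))
          ` {i. 1 \<le> i \<and> real i \<le> \<alpha>0 * real n})"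

definition HC_reject_prob :: "real \<Rightarrow> nat \<Rightarrow> (nat \<Rightarrow> real) measure \<Rightarrow> real \<Rightarrow> real" where
  "HC_reject_prob \<alpha>0 n P t = measure P {X \<in> space P. HC \<alpha>0 n X > t}"

definition HC_critical_values :: "real \<Rightarrow> (nat \<Rightarrow> real \<Rightarrow> real) \<Rightarrow> bool" where
  "HC_critical_values \<alpha>0 h \<longleftrightarrow>
     (\<forall>n \<alpha>. 1 \<le> \<alpha>0 * real n \<longrightarrow> 0 < \<alpha> \<longrightarrow> \<alpha> < 1 \<longrightarrow> HC_reject_prob \<alpha>0 n (H0 n) (h n \<alpha>) \<le> \<alpha>)"

definition tends_to_0_slowly_enough :: "(nat \<Rightarrow> real \<Rightarrow> real) \<Rightarrow> (nat \<Rightarrow> real) \<Rightarrow> bool" where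
  "tends_to_0_slowly_enough h \<alpha> \<longleftrightarrow>
     \<alpha> \<longlonglongrightarrow> 0 \<and> (\<lambda>n. h n (\<alpha> n)) \<sim>[sequentially] (\<lambda>n. sqrt (2 * ln (ln (real n))))"


section \<open>The detection boundary\<close>

definition rho_Exp :: "real \<Rightarrow> real" where
  "rho_Exp \<beta> = (if \<beta> \<le> 3 / 4 then \<beta> - 1 / 2 else (1 - sqrt (1 - \<beta>))\<^sup>2)"

end

theory Submission
  imports Defs "HOL-Real_Asymp.Real_Asymp"
begin

text \<open>If \<open>r < \<rho>(\<beta>)\<close>, the likelihood ratio, truncated at observations below \<open>2 log n\<close>, converges to 1 in
  \<open>L\<^sup>2\<close> under the null, which bounds the sum of errors of every test from below. No formula for
  the density of the noncentral chi-squared law is needed: shifting the Gaussian plane shows that this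
  law is at most \<open>exp (sqrt (\<delta> x) - \<delta> / 2)\<close> times \<open>Exp(2)\<close>, and this factor is sharp on the exponential
  scale. The failure of higher criticism follows, because its level tends to 0.

  If \<open>r > \<rho>(\<beta>)\<close>, it suffices to count the p-values below a single threshold \<open>n\<^sup>-\<^sup>s\<close>, where \<open>sqrt s\<close> is
  \<open>min (2 sqrt r) 1\<close>. By Chebyshev's inequality the normalised count exceeds \<open>log n\<close> with probability
  tending to 0 under the null and to 1 under the alternative. This test separates the hypotheses, and since
  the normalised count is a lower bound of the higher criticism statistic, the latter exceeds its
  critical value \<open>sqrt (2 log log n) (1 + o(1))\<close> as well.\<close>

section \<open>Bounds for the noncentral chi-squared law\<close>

lemma borel_measurable_fst_snd [measurable]:
  "fst \<in> borel_measurable (borel :: (real \<times> real) measure)"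
  "snd \<in> borel_measurable (borel :: (real \<times> real) measure)"
  by (intro borel_measurable_continuous_onI continuous_intros)+

text \<open>A disc of radius \<open>sqrt t\<close> has area \<open>pi * t\<close>, which is linear
  in \<open>t\<close>; hence the squared radius carries planar Lebesgue measure to \<open>pi\<close>
  times Lebesgue measure on the half-line. This takes the place of polar coordinates.\<close>

lemma distr_lborel_sum_squares:
  "distr (lborel :: (real \<times> real) measure) borel (\<lambda>z. (fst z)\<^sup>2 + (snd z)\<^sup>2) =
     density lborel (\<lambda>x. ennreal pi * indicator {0..} x)" (is "?L = ?R")
proof (rule measure_eqI_generator_eq[where E = "range atMost" and A = "\<lambda>i. {.. real i}" and \<Omega> = UNIV])
  show "Int_stable (range (atMost :: real \<Rightarrow> real set))"
    by (auto simp: Int_stable_def)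
  show "sets ?L = sigma_sets UNIV (range atMost)" "sets ?R = sigma_sets UNIV (range atMost)"
    by (simp_all add: borel_eq_atMost)
  have L: "emeasure ?L {..t} = ennreal (pi * max 0 t)" for t :: real
  proof (cases "t \<ge> 0")
    case True
    have "emeasure ?L {..t} = emeasure lborel {z :: real \<times> real. (fst z)\<^sup>2 + (snd z)\<^sup>2 \<le> t}"
      by (subst emeasure_distr) (auto intro!: arg_cong2[where f = emeasure])
    also have "{z :: real \<times> real. (fst z)\<^sup>2 + (snd z)\<^sup>2 \<le> t} = cball 0 (sqrt t)"
      using True by (auto simp: dist_prod_def dist_norm)
    also have "emeasure lborel \<dots> = ennreal (pi * t)"
      using True by (subst emeasure_cball) (simp_all add: unit_ball_vol_2)
    finally show ?thesis
      using True by simp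
  next
    case False
    have "\<not> (fst z)\<^sup>2 + (snd z)\<^sup>2 \<le> t" for z :: "real \<times> real"
      using sum_power2_ge_zero[of "fst z" "snd z"] False by linarith
    then have "(\<lambda>z. (fst z)\<^sup>2 + (snd z)\<^sup>2) -` {..t} = ({} :: (real \<times> real) set)"
      by auto
    then have "emeasure ?L {..t} = 0"
      by (subst emeasure_distr) auto
    then show ?thesis
      using False by simp
  qed
  have R: "emeasure ?R {..t} = ennreal (pi * max 0 t)" for t :: real
  proof -
    have "emeasure ?R {..t} = (\<integral>\<^sup>+x. ennreal pi * indicator {0..t} x \<partial>lborel)"
      by (subst emeasure_density)
         (auto simp: mult.assoc indicator_def intro!: nn_integral_cong)
    also have "\<dots> = ennreal (pi * max 0 t)"
      by (subst nn_integral_cmult) (auto simp: ennreal_mult max_def)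
    finally show ?thesis .
  qed
  show "emeasure ?L X = emeasure ?R X" if "X \<in> range atMost" for X
    using that L R by auto
  show "(\<Union>i. {..real i}) = UNIV"
    by (auto intro: real_arch_simple)
  show "emeasure ?L {..real i} \<noteq> \<infinity>" for i
    by (simp add: L)
qed auto

lemma nn_integral_sum_squares:
  assumes [measurable]: "f \<in> borel_measurable borel"
  shows "(\<integral>\<^sup>+z. f ((fst z)\<^sup>2 + (snd z)\<^sup>2) \<partial>(lborel :: (real \<times> real) measure)) =
    (\<integral>\<^sup>+x. ennreal pi * indicator {0..} x * f x \<partial>lborel)"
proof -
  have "(\<integral>\<^sup>+z. f ((fst z)\<^sup>2 + (snd z)\<^sup>2) \<partial>(lborel :: (real \<times> real) measure)) =
    (\<integral>\<^sup>+x. f x \<partial>distr (lborel :: (real \<times> real) measure) borel (\<lambda>z. (fst z)\<^sup>2 + (snd z)\<^sup>2))"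
    by (subst nn_integral_distr) auto
  then show ?thesis
    by (simp add: distr_lborel_sum_squares nn_integral_density)
qed

text \<open>Translating the plane by \<open>(sqrt d, 0)\<close> moves the noncentrality out of the
  squared distance and into the Gaussian density. The event then depends on the radius alone, so a
  radial bound on the density suffices to reduce the integral to one dimension.\<close>

lemma emeasure_ncchisq2:
  assumes [measurable]: "A \<in> sets borel"
  shows "emeasure (ncchisq2 d) A =
    (\<integral>\<^sup>+z. ennreal (std_normal_density (fst z - sqrt d) * std_normal_density (snd z)) *
       indicator A ((fst z)\<^sup>2 + (snd z)\<^sup>2) \<partial>(lborel :: (real \<times> real) measure))"
proof -
  interpret N: prob_space std_normal by (rule prob_space_std_normal)
  interpret NN: pair_prob_space std_normal std_normal ..
  have sN [measurable_cong]: "sets std_normal = sets borel"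
    by (simp add: std_normal_def)
  have pair: "std_normal \<Otimes>\<^sub>M std_normal = density lborel
      (\<lambda>z. ennreal (std_normal_density (fst z) * std_normal_density (snd z)))"
  proof -
    have "sigma_finite_measure std_normal"
      by (rule N.sigma_finite_measure_axioms)
    then show ?thesis
      unfolding std_normal_def
      by (subst pair_measure_density)
         (auto simp: lborel_prod split_beta' ennreal_mult lborel.sigma_finite_measure_axioms)
  qed
  let ?f = "\<lambda>z. ennreal (std_normal_density (fst z - sqrt d) * std_normal_density (snd z)) *
       indicator A ((fst z)\<^sup>2 + (snd z)\<^sup>2) :: ennreal"
  have "emeasure (ncchisq2 d) A = (\<integral>\<^sup>+x. indicator A x \<partial>ncchisq2 d)"
    by simp
  also have "\<dots> = (\<integral>\<^sup>+z. indicator A ((fst z + sqrt d)\<^sup>2 + (snd z)\<^sup>2) \<partial>(std_normal \<Otimes>\<^sub>M std_normal))"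
    unfolding ncchisq2_def by (subst nn_integral_distr) (auto simp: split_beta)
  also have "\<dots> = (\<integral>\<^sup>+z. ?f ((sqrt d, 0) + z) \<partial>lborel)"
    unfolding pair by (subst nn_integral_density) (auto simp: add.commute)
  also have "\<dots> = (\<integral>\<^sup>+z. ?f z \<partial>distr lborel borel ((+) (sqrt d, 0)))"
    by (subst nn_integral_distr) auto
  also have "\<dots> = (\<integral>\<^sup>+z. ?f z \<partial>lborel)"
    by (simp only: lborel_distr_plus)
  finally show ?thesis .
qed

text \<open>For nonnegative arguments this is the maximum, over the circle of squared radius
  \<open>x\<close>, of the shifted Gaussian density divided by the centred one. The exact likelihood
  ratio is the average over that circle, \<open>exp (- d / 2)\<close> times the modified Bessel
  function of order 0 at \<open>sqrt (d * x)\<close>.\<close>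

definition ncchisq2_bound :: "real \<Rightarrow> real \<Rightarrow> real" where
  "ncchisq2_bound d x = exp (sqrt (d * x) - d / 2)"

lemma borel_measurable_ncchisq2_bound [measurable]: "ncchisq2_bound d \<in> borel_measurable borel"
  unfolding ncchisq2_bound_def by measurable

text \<open>A coordinate is at most the radius, which bounds the cross term
  \<open>sqrt d * x\<close> of the exponent by a radial one.\<close>

lemma shifted_normal_density_le:
  assumes "0 \<le> d"
  shows "std_normal_density (x - sqrt d) * std_normal_density y \<le>
    ncchisq2_bound d (x\<^sup>2 + y\<^sup>2) * (exp (- (x\<^sup>2 + y\<^sup>2) / 2) / (2 * pi))"
proof -
  have "x \<le> sqrt (x\<^sup>2 + y\<^sup>2)"
    by (rule real_le_rsqrt) simp
  then have "sqrt d * x \<le> sqrt (d * (x\<^sup>2 + y\<^sup>2))"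
    using assms by (simp add: real_sqrt_mult mult_left_mono)
  then have "- (x - sqrt d)\<^sup>2 / 2 + - y\<^sup>2 / 2 \<le> (sqrt (d * (x\<^sup>2 + y\<^sup>2)) - d / 2) + - (x\<^sup>2 + y\<^sup>2) / 2"
    using assms by (simp add: power2_diff field_simps)
  then have "exp (- (x - sqrt d)\<^sup>2 / 2) * exp (- y\<^sup>2 / 2) \<le>
      ncchisq2_bound d (x\<^sup>2 + y\<^sup>2) * exp (- (x\<^sup>2 + y\<^sup>2) / 2)"
    unfolding ncchisq2_bound_def exp_add[symmetric] by simp
  then have "(exp (- (x - sqrt d)\<^sup>2 / 2) * exp (- y\<^sup>2 / 2)) / (2 * pi) \<le>
      (ncchisq2_bound d (x\<^sup>2 + y\<^sup>2) * exp (- (x\<^sup>2 + y\<^sup>2) / 2)) / (2 * pi)"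
    by (intro divide_right_mono) auto
  then show ?thesis
    by (simp add: normal_density_def field_simps)
qed

text \<open>The comparison is setwise, in the order on measures, so that later integrals against the
  noncentral law can be bounded without knowing its density.\<close>

lemma ncchisq2_le:
  assumes "0 \<le> d"
  shows "ncchisq2 d \<le> density Exp2 (ncchisq2_bound d)"
proof (subst le_measure)
  show "\<forall>A\<in>sets (ncchisq2 d). emeasure (ncchisq2 d) A \<le> emeasure (density Exp2 (ncchisq2_bound d)) A"
  proof
    fix A assume "A \<in> sets (ncchisq2 d)"
    then have [measurable]: "A \<in> sets borel"
      by simp
    let ?h = "\<lambda>x. ennreal (ncchisq2_bound d x * (exp (- x / 2) / (2 * pi))) * indicator A x :: ennreal"
    have "emeasure (ncchisq2 d) A \<le> (\<integral>\<^sup>+z. ?h ((fst z)\<^sup>2 + (snd z)\<^sup>2) \<partial>(lborel :: (real \<times> real) measure))"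
      unfolding emeasure_ncchisq2[OF \<open>A \<in> sets borel\<close>]
      by (intro nn_integral_mono mult_right_mono ennreal_leI shifted_normal_density_le assms) simp
    also have "\<dots> = (\<integral>\<^sup>+x. ennreal pi * indicator {0..} x * ?h x \<partial>lborel)"
      by (rule nn_integral_sum_squares) measurable
    \<comment> \<open>The area factor \<open>pi\<close> cancels against \<open>1 / (2 * pi)\<close>
      and leaves \<open>1 / 2\<close>, the rate of \<open>Exp2\<close>.\<close>
    also have "\<dots> = (\<integral>\<^sup>+x. ennreal (exponential_density (1 / 2) x) * (ennreal (ncchisq2_bound d x) * indicator A x) \<partial>lborel)"
      by (intro nn_integral_cong)
         (auto simp: indicator_def exponential_density_def ncchisq2_bound_def simp flip: ennreal_mult)
    also have "\<dots> = emeasure (density Exp2 (ncchisq2_bound d)) A"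
      unfolding Exp2_def by (simp add: emeasure_density nn_integral_density)
    finally show "emeasure (ncchisq2 d) A \<le> emeasure (density Exp2 (ncchisq2_bound d)) A" .
  qed
qed auto

text \<open>If the first Gaussian coordinate is at least \<open>b - sqrt d\<close>, the squared
  distance is already at least \<open>b\<^sup>2\<close>. The mass of this event is bounded below by
  the smallest value of the density on a unit interval. In the application \<open>b - sqrt d\<close>
  is of order \<open>sqrt (ln n)\<close>, so the extra 1 in the exponent costs only a subpolynomial
  factor.\<close>

lemma ncchisq2_tail_ge:
  assumes "0 \<le> d" "sqrt d \<le> b"
  shows "exp (- (b - sqrt d + 1)\<^sup>2 / 2) / sqrt (2 * pi) \<le> measure (ncchisq2 d) {b\<^sup>2 ..}"
proof -
  interpret N: prob_space std_normal by (rule prob_space_std_normal)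
  interpret NN: pair_prob_space std_normal std_normal ..
  interpret C: prob_space "ncchisq2 d" by (rule prob_space_ncchisq2)
  have sN [measurable_cong]: "sets std_normal = sets borel" and [simp]: "space std_normal = UNIV"
    by (simp_all add: std_normal_def)
  define a where "a = b - sqrt d"
  have "a \<ge> 0" "b \<ge> 0"
    using assms order.trans[OF real_sqrt_ge_zero[OF assms(1)] assms(2)] by (auto simp: a_def)
  have "ennreal (exp (- (a + 1)\<^sup>2 / 2) / sqrt (2 * pi)) =
      (\<integral>\<^sup>+x. ennreal (exp (- (a + 1)\<^sup>2 / 2) / sqrt (2 * pi)) * indicator {a..a+1} x \<partial>lborel)"
    by (subst nn_integral_cmult) auto
  also have "\<dots> \<le> (\<integral>\<^sup>+x. ennreal (std_normal_density x) * indicator {a..} x \<partial>lborel)"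
  proof (intro nn_integral_mono)
    fix x :: real
    have "exp (- (a + 1)\<^sup>2 / 2) / sqrt (2 * pi) \<le> std_normal_density x" if "a \<le> x" "x \<le> a + 1"
    proof -
      have "x\<^sup>2 \<le> (a + 1)\<^sup>2"
        using that \<open>a \<ge> 0\<close> by (intro power_mono) auto
      then have "exp (- (a + 1)\<^sup>2 / 2) / sqrt (2 * pi) \<le> exp (- x\<^sup>2 / 2) / sqrt (2 * pi)"
        by (intro divide_right_mono) auto
      then show ?thesis
        by (simp add: normal_density_def)
    qed
    then show "ennreal (exp (- (a + 1)\<^sup>2 / 2) / sqrt (2 * pi)) * indicator {a..a+1} x
        \<le> ennreal (std_normal_density x) * indicator {a..} x"
      by (auto simp: indicator_def intro: ennreal_leI)
  qed
  also have "\<dots> = emeasure std_normal {a..}"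
    unfolding std_normal_def by (simp add: emeasure_density)
  also have "\<dots> = emeasure (std_normal \<Otimes>\<^sub>M std_normal) ({a..} \<times> UNIV)"
    using N.emeasure_space_1 by (subst N.emeasure_pair_measure_Times) (auto simp: sN)
  also have "\<dots> \<le> emeasure (std_normal \<Otimes>\<^sub>M std_normal)
      ((\<lambda>(z1, z2). (z1 + sqrt d)\<^sup>2 + z2\<^sup>2) -` {b\<^sup>2..} \<inter> space (std_normal \<Otimes>\<^sub>M std_normal))"
  proof (intro emeasure_mono)
    show "{a..} \<times> UNIV \<subseteq> (\<lambda>(z1, z2). (z1 + sqrt d)\<^sup>2 + z2\<^sup>2) -` {b\<^sup>2..} \<inter> space (std_normal \<Otimes>\<^sub>M std_normal)"
    proof -
      have "b\<^sup>2 \<le> (x + sqrt d)\<^sup>2 + y\<^sup>2" if "a \<le> x" for x y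
        using power_mono[of b "x + sqrt d" 2] that \<open>b \<ge> 0\<close> by (simp add: a_def add_increasing2)
      then show ?thesis
        by (auto simp: space_pair_measure)
    qed
  qed measurable
  also have "\<dots> = emeasure (ncchisq2 d) {b\<^sup>2..}"
    unfolding ncchisq2_def by (subst emeasure_distr) auto
  finally show ?thesis
    by (simp add: a_def C.emeasure_eq_measure)
qed

section \<open>Errors of tests between product measures\<close>

lemma PiM_density:
  fixes f :: "'a \<Rightarrow> ennreal"
  assumes I: "finite I" and "prob_space M" and [measurable]: "f \<in> borel_measurable M"
    and "prob_space (density M f)"
  shows "PiM I (\<lambda>_. density M f) = density (PiM I (\<lambda>_. M)) (\<lambda>x. \<Prod>i\<in>I. f (x i))"
proof -
  interpret M: prob_space M by fact
  interpret N: prob_space "density M f" by fact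
  interpret PM: product_sigma_finite "\<lambda>_. M" ..
  interpret PN: product_sigma_finite "\<lambda>_. density M f" ..
  show ?thesis
  proof (rule PN.PiM_eqI[symmetric])
    show "sets (density (PiM I (\<lambda>_. M)) (\<lambda>x. \<Prod>i\<in>I. f (x i))) = sets (PiM I (\<lambda>_. density M f))"
      by (simp cong: sets_PiM_cong)
    fix A assume "\<And>i. i \<in> I \<Longrightarrow> A i \<in> sets (density M f)"
    then have A [measurable]: "\<And>i. i \<in> I \<Longrightarrow> A i \<in> sets M"
      by simp
    have "emeasure (density (PiM I (\<lambda>_. M)) (\<lambda>x. \<Prod>i\<in>I. f (x i))) (Pi\<^sub>E I A) =
        (\<integral>\<^sup>+x. (\<Prod>i\<in>I. f (x i)) * indicator (Pi\<^sub>E I A) x \<partial>PiM I (\<lambda>_. M))"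
      using I A by (intro emeasure_density) auto
    also have "\<dots> = (\<integral>\<^sup>+x. (\<Prod>i\<in>I. f (x i) * indicator (A i) (x i)) \<partial>PiM I (\<lambda>_. M))"
    proof (intro nn_integral_cong)
      fix x assume "x \<in> space (PiM I (\<lambda>_. M))"
      then have "indicator (Pi\<^sub>E I A) x = (\<Prod>i\<in>I. indicator (A i) (x i) :: ennreal)"
        using I by (auto simp: indicator_def space_PiM PiE_iff prod.If_cases intro!: prod_zero)
      then show "(\<Prod>i\<in>I. f (x i)) * indicator (Pi\<^sub>E I A) x = (\<Prod>i\<in>I. f (x i) * indicator (A i) (x i))"
        by (simp add: prod.distrib)
    qed
    also have "\<dots> = (\<Prod>i\<in>I. \<integral>\<^sup>+x. f x * indicator (A i) x \<partial>M)"
      using I A by (intro PM.product_nn_integral_prod) auto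
    also have "\<dots> = (\<Prod>i\<in>I. emeasure (density M f) (A i))"
      using A by (intro prod.cong) (auto simp: emeasure_density)
    finally show "emeasure (density (PiM I (\<lambda>_. M)) (\<lambda>x. \<Prod>i\<in>I. f (x i))) (Pi\<^sub>E I A) =
        (\<Prod>i\<in>I. emeasure (density M f) (A i))" .
  qed fact
qed

lemma (in prob_space) expectation_abs_le:
  fixes X :: "'a \<Rightarrow> real"
  assumes "integrable M X" "integrable M (\<lambda>x. (X x)\<^sup>2)"
  shows "expectation (\<lambda>x. \<bar>X x\<bar>) \<le> sqrt (expectation (\<lambda>x. (X x)\<^sup>2))"
proof -
  have "0 \<le> variance (\<lambda>x. \<bar>X x\<bar>)"
    by (rule variance_positive)
  also have "\<dots> = expectation (\<lambda>x. (X x)\<^sup>2) - (expectation (\<lambda>x. \<bar>X x\<bar>))\<^sup>2"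
    using assms by (subst variance_eq) auto
  finally show ?thesis
    by (intro real_le_rsqrt) simp
qed

text \<open>With \<open>g = f\<close> the bound is void when \<open>f\<close> has a large second moment; \<open>g\<close> is meant as a truncation of \<open>f\<close>.\<close>

lemma PiM_error_sum_ge:
  fixes f :: "'a \<Rightarrow> ennreal" and g :: "'a \<Rightarrow> real"
  assumes I: "finite I" and "prob_space M" and f [measurable]: "f \<in> borel_measurable M"
    and "prob_space (density M f)"
    and g [measurable]: "g \<in> borel_measurable M" "\<And>x. 0 \<le> g x" "\<And>x. ennreal (g x) \<le> f x"
    and g2: "integrable M (\<lambda>x. (g x)\<^sup>2)"
    and A [measurable]: "A \<in> sets (PiM I (\<lambda>_. M))"
  defines "Q \<equiv> PiM I (\<lambda>_. density M f)"
  shows "1 - sqrt (1 - 2 * (\<integral>x. g x \<partial>M) ^ card I + (\<integral>x. (g x)\<^sup>2 \<partial>M) ^ card I)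
    \<le> measure (PiM I (\<lambda>_. M)) A + measure Q (space Q - A)"
proof -
  interpret M: prob_space M by fact
  interpret N: prob_space "density M f" by fact
  interpret PM: product_sigma_finite "\<lambda>_. M" ..
  interpret P: prob_space "PiM I (\<lambda>_. M)" by (rule prob_space_PiM[OF M.prob_space_axioms])
  interpret Q: prob_space Q unfolding Q_def by (rule prob_space_PiM[OF N.prob_space_axioms])
  define P where "P = PiM I (\<lambda>_. M)"
  define G where "G = (\<lambda>x. \<Prod>i\<in>I. g (x i))"
  define F where "F = (\<lambda>x. \<Prod>i\<in>I. f (x i))"
  have Q: "Q = density P F"
    unfolding Q_def P_def F_def by (rule PiM_density) fact+
  have [measurable]: "G \<in> borel_measurable P" "F \<in> borel_measurable P" "A \<in> sets P"
    by (simp_all add: G_def F_def P_def)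
  have G0: "0 \<le> G x" for x
    by (simp add: G_def prod_nonneg g)
  have GF: "ennreal (G x) \<le> F x" for x
    unfolding G_def F_def by (subst prod_ennreal[symmetric]) (auto intro!: prod_mono_ennreal g)
  have g1: "integrable M g"
    by (rule M.square_integrable_imp_integrable[OF _ g2]) measurable
  have intG: "integrable P G" and EG: "(\<integral>x. G x \<partial>P) = (\<integral>x. g x \<partial>M) ^ card I"
    unfolding G_def P_def using PM.product_integrable_prod[OF I, of "\<lambda>_. g"]
      PM.product_integral_prod[OF I, of "\<lambda>_. g"] g1 by auto
  have intG2: "integrable P (\<lambda>x. (G x)\<^sup>2)" and EG2: "(\<integral>x. (G x)\<^sup>2 \<partial>P) = (\<integral>x. (g x)\<^sup>2 \<partial>M) ^ card I"
    unfolding G_def P_def prod_power_distrib[symmetric]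
    using PM.product_integrable_prod[OF I, of "\<lambda>_ x. (g x)\<^sup>2"]
      PM.product_integral_prod[OF I, of "\<lambda>_ x. (g x)\<^sup>2"] g2 by (auto simp: prod_power_distrib)
  have sq: "(1 - G x)\<^sup>2 = 1 - 2 * G x + (G x)\<^sup>2" for x
    by (simp add: power2_eq_square algebra_simps)
  have int: "integrable P (\<lambda>x. 1 - G x)" "integrable P (\<lambda>x. (1 - G x)\<^sup>2)"
    unfolding sq using intG intG2 P.integrable_const by (auto simp: P_def)
  \<comment> \<open>The mean absolute deviation of the truncated ratio from 1 is bounded by the root
    mean square. The cross term remains, since truncation may lower the mean of \<open>G\<close>
    below 1.\<close>
  have "(\<integral>x. \<bar>1 - G x\<bar> \<partial>P) \<le> sqrt (\<integral>x. (1 - G x)\<^sup>2 \<partial>P)"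
    unfolding P_def by (rule P.expectation_abs_le) (use int in \<open>auto simp: P_def\<close>)
  also have "(\<integral>x. (1 - G x)\<^sup>2 \<partial>P) = 1 - 2 * (\<integral>x. G x \<partial>P) + (\<integral>x. (G x)\<^sup>2 \<partial>P)"
    unfolding sq using intG intG2 P.prob_space P.integrable_const[of "1::real"] by (simp add: P_def)
  finally have *: "(\<integral>x. \<bar>1 - G x\<bar> \<partial>P) \<le>
      sqrt (1 - 2 * (\<integral>x. g x \<partial>M) ^ card I + (\<integral>x. (g x)\<^sup>2 \<partial>M) ^ card I)"
    by (simp add: EG EG2)
  have intB: "integrable P (\<lambda>x. G x * indicator (space P - A) x)"
    using integrable_mult_indicator[of "space P - A" P G] intG by (simp add: mult.commute)
  have "ennreal (\<integral>x. G x * indicator (space P - A) x \<partial>P) =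
      (\<integral>\<^sup>+x. ennreal (G x * indicator (space P - A) x) \<partial>P)"
    using intB G0 by (intro nn_integral_eq_integral[symmetric]) auto
  also have "\<dots> \<le> (\<integral>\<^sup>+x. F x * indicator (space P - A) x \<partial>P)"
    using GF by (intro nn_integral_mono) (auto simp: indicator_def)
  also have "\<dots> = ennreal (measure Q (space P - A))"
    unfolding Q.emeasure_eq_measure[symmetric] unfolding Q
    by (subst emeasure_density) auto
  finally have "(\<integral>x. G x * indicator (space P - A) x \<partial>P) \<le> measure Q (space P - A)"
    by simp
  moreover have "measure P A = (\<integral>x. indicator A x \<partial>P)"
    by simp
  moreover have intA: "integrable P (indicator A :: _ \<Rightarrow> real)"
    unfolding P_def by (simp add: P.emeasure_eq_measure)
  ultimately have "(\<integral>x. indicator A x + G x * indicator (space P - A) x \<partial>P)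
      \<le> measure P A + measure Q (space P - A)"
    using intB by simp
  \<comment> \<open>Both 1 and \<open>G x\<close> dominate \<open>1 - \<bar>1 - G x\<bar>\<close>,
    so the inequality holds whichever hypothesis the test picks at \<open>x\<close>.\<close>
  moreover have "(\<integral>x. 1 - \<bar>1 - G x\<bar> \<partial>P) \<le> (\<integral>x. indicator A x + G x * indicator (space P - A) x \<partial>P)"
  proof (rule integral_mono)
    show "integrable P (\<lambda>x. 1 - \<bar>1 - G x\<bar>)"
      using int P.integrable_const by (auto simp: P_def)
    show "integrable P (\<lambda>x. indicator A x + G x * indicator (space P - A) x)"
      using intA intB by simp
  qed (use G0 in \<open>auto simp: indicator_def abs_if\<close>)
  moreover have "(\<integral>x. 1 - \<bar>1 - G x\<bar> \<partial>P) = 1 - (\<integral>x. \<bar>1 - G x\<bar> \<partial>P)"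
    using int P.prob_space P.integrable_const[of "1::real"] by (simp add: P_def)
  moreover have "space Q = space P"
    by (simp add: Q)
  ultimately show ?thesis
    using * by (simp add: P_def)
qed

section \<open>Mixtures with a dominated contamination\<close>

lemma mixture_eq_density:
  assumes "prob_space M" "prob_space N" "sets N = sets M" "absolutely_continuous M N"
  shows "mixture e M N = density M (\<lambda>x. ennreal (1 - e) + ennreal e * RN_deriv M N x)"
proof (rule measure_eqI)
  interpret M: prob_space M by fact
  fix A assume "A \<in> sets (mixture e M N)"
  then have [measurable]: "A \<in> sets M"
    by simp
  have "emeasure N A = (\<integral>\<^sup>+x. RN_deriv M N x * indicator A x \<partial>M)"
    using M.density_RN_deriv[OF assms(4,3)] by (metis \<open>A \<in> sets M\<close> borel_measurable_RN_deriv emeasure_density)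
  then show "emeasure (mixture e M N) A =
      emeasure (density M (\<lambda>x. ennreal (1 - e) + ennreal e * RN_deriv M N x)) A"
    using assms
    by (simp add: emeasure_mixture emeasure_density distrib_right nn_integral_add nn_integral_cmult mult.assoc)
qed simp

text \<open>The truncation restricts the ratio of \<open>N\<close> to \<open>M\<close> to the set
  \<open>B\<close> and keeps the null part \<open>1 - e\<close> intact. The first moment then loses
  \<open>e\<close> times the mass of \<open>N\<close> outside \<open>B\<close>, and the second
  moment exceeds 1 by at most \<open>e\<^sup>2 * K\<close>. Over the sample both moments are raised
  to the power \<open>card I\<close>.\<close>

lemma mixture_error_sum_ge:
  fixes m :: "'a \<Rightarrow> real"
  assumes "finite I" "prob_space M" "prob_space N" and sets: "sets N = sets M"
    and [measurable]: "m \<in> borel_measurable M" and le: "N \<le> density M m"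
    and [measurable]: "B \<in> sets M" and K: "(\<integral>\<^sup>+x. ennreal ((m x)\<^sup>2) * indicator B x \<partial>M) \<le> ennreal K" "0 \<le> K"
    and m: "\<And>x. 0 \<le> m x"
    and e: "0 \<le> e" "e \<le> 1"
    and A: "A \<in> sets (PiM I (\<lambda>_. M))"
  defines "Q \<equiv> PiM I (\<lambda>_. mixture e M N)"
  shows "absolutely_continuous (PiM I (\<lambda>_. M)) Q"
    and "1 - sqrt (1 - 2 * (1 - e * (1 - measure N B)) ^ card I + (1 + e\<^sup>2 * K) ^ card I)
    \<le> measure (PiM I (\<lambda>_. M)) A + measure Q (space Q - A)"
proof -
  interpret M: prob_space M by fact
  interpret N: prob_space N by fact
  have [measurable_cong]: "sets N = sets M" by fact
  have le': "emeasure N X \<le> emeasure (density M m) X" for X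
    using le_measureD3[OF le] sets by simp
  have ac: "absolutely_continuous M N"
    unfolding absolutely_continuous_def
  proof
    fix X assume "X \<in> null_sets M"
    then have "X \<in> null_sets (density M m)"
      using absolutely_continuousI_density[of "\<lambda>x. ennreal (m x)" M] by (auto simp: absolutely_continuous_def)
    then show "X \<in> null_sets N"
      using le'[of X] by (auto simp: null_sets_def sets)
  qed
  define L where "L = RN_deriv M N"
  define l where "l x = enn2real (L x)" for x
  have L [measurable]: "L \<in> borel_measurable M" "l \<in> borel_measurable M"
    by (simp_all add: L_def l_def[abs_def])
  have N: "N = density M L"
    using M.density_RN_deriv[OF ac sets] by (simp add: L_def)
  have fin: "AE x in M. L x \<noteq> \<infinity>"
    unfolding L_def by (rule M.RN_deriv_finite) (use ac sets N.sigma_finite_measure_axioms in auto)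
  have lL: "AE x in M. ennreal (l x) = L x"
    using fin by eventually_elim (simp add: l_def less_top)
  have l0: "0 \<le> l x" for x
    by (simp add: l_def)
  define f where "f = (\<lambda>x. ennreal (1 - e) + ennreal e * L x)"
  define g where "g = (\<lambda>x. (1 - e) + e * (l x * indicator B x))"
  have [measurable]: "f \<in> borel_measurable M" "g \<in> borel_measurable M"
    by (simp_all add: f_def g_def)
  have mix: "mixture e M N = density M f"
    unfolding f_def L_def by (rule mixture_eq_density) fact+
  have pf: "prob_space (density M f)"
    unfolding mix[symmetric] by (rule prob_space_mixture) fact+
  have Q: "Q = density (PiM I (\<lambda>_. M)) (\<lambda>x. \<Prod>i\<in>I. f (x i))"
    unfolding Q_def mix by (rule PiM_density) fact+
  show "absolutely_continuous (PiM I (\<lambda>_. M)) Q"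
    unfolding Q by (intro absolutely_continuousI_density) measurable
  \<comment> \<open>The domination of measures is used twice: one factor \<open>L\<close> turns
    integration over \<open>M\<close> into integration over \<open>N\<close>, which is dominated by
    \<open>density M m\<close>, and then the other factor does the same. This replaces the square of
    \<open>L\<close> by that of \<open>m\<close> with no pointwise comparison of the two.\<close>
  have "(\<integral>\<^sup>+x. ennreal ((l x)\<^sup>2 * indicator B x) \<partial>M) = (\<integral>\<^sup>+x. L x * (L x * indicator B x) \<partial>M)"
    by (rule nn_integral_cong_AE, use lL in eventually_elim)
       (auto simp: power2_eq_square l0 indicator_def ennreal_mult)
  also have "\<dots> = (\<integral>\<^sup>+x. L x * indicator B x \<partial>N)"
    unfolding N by (subst nn_integral_density) auto
  also have "\<dots> \<le> (\<integral>\<^sup>+x. L x * indicator B x \<partial>density M m)"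
    by (rule nn_integral_mono_measure) (use sets le in auto)
  also have "\<dots> = (\<integral>\<^sup>+x. L x * (ennreal (m x) * indicator B x) \<partial>M)"
    by (subst nn_integral_density) (auto simp: ac_simps)
  also have "\<dots> = (\<integral>\<^sup>+x. ennreal (m x) * indicator B x \<partial>N)"
    unfolding N by (subst nn_integral_density) auto
  also have "\<dots> \<le> (\<integral>\<^sup>+x. ennreal (m x) * indicator B x \<partial>density M m)"
    by (rule nn_integral_mono_measure) (use sets le in auto)
  also have "\<dots> = (\<integral>\<^sup>+x. ennreal ((m x)\<^sup>2) * indicator B x \<partial>M)"
    by (subst nn_integral_density) (auto simp: power2_eq_square ennreal_mult m ac_simps)
  also note K(1)
  finally have l2: "(\<integral>\<^sup>+x. ennreal ((l x)\<^sup>2 * indicator B x) \<partial>M) \<le> ennreal K" .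
  have int_l2: "integrable M (\<lambda>x. (l x)\<^sup>2 * indicator B x)"
    using l2 by (intro integrableI_nonneg) (auto simp: le_less_trans)
  have El2: "(\<integral>x. (l x)\<^sup>2 * indicator B x \<partial>M) \<le> K"
    using l2 K(2) nn_integral_eq_integral[OF int_l2] by simp
  have "(\<integral>\<^sup>+x. ennreal (l x * indicator B x) \<partial>M) = (\<integral>\<^sup>+x. L x * indicator B x \<partial>M)"
    by (rule nn_integral_cong_AE, use lL in eventually_elim) (simp add: indicator_def)
  also have "\<dots> = emeasure N B"
    unfolding N by (simp add: emeasure_density)
  also have "\<dots> = ennreal (measure N B)"
    by (rule N.emeasure_eq_measure)
  finally have l1: "(\<integral>\<^sup>+x. ennreal (l x * indicator B x) \<partial>M) = ennreal (measure N B)" .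
  have int_l1: "integrable M (\<lambda>x. l x * indicator B x)"
    using l1 l0 by (intro integrableI_nonneg) auto
  have El1: "(\<integral>x. l x * indicator B x \<partial>M) = measure N B"
    using l1 l0 nn_integral_eq_integral[OF int_l1] by simp
  have g0: "0 \<le> g x" for x
    using e l0 by (simp add: g_def)
  \<comment> \<open>\<open>enn2real\<close> sends an infinite value of \<open>L\<close> to 0, so the
    comparison holds at every point and not only almost everywhere.\<close>
  have gf: "ennreal (g x) \<le> f x" for x
  proof -
    have "ennreal (g x) = ennreal (1 - e) + ennreal e * ennreal (l x * indicator B x)"
      using e l0[of x] by (simp add: g_def ennreal_mult[symmetric] flip: ennreal_plus)
    also have "\<dots> \<le> f x"
      unfolding f_def
      by (intro add_left_mono mult_left_mono) (auto simp: indicator_def l_def ennreal_enn2real_if)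
    finally show ?thesis .
  qed
  have g2: "(g x)\<^sup>2 = (1 - e)\<^sup>2 + 2 * (1 - e) * e * (l x * indicator B x) + e\<^sup>2 * ((l x)\<^sup>2 * indicator B x)" for x
    by (simp add: g_def indicator_def power2_eq_square algebra_simps)
  have int_g2: "integrable M (\<lambda>x. (g x)\<^sup>2)"
    unfolding g2 using int_l1 int_l2 by simp
  have Eg: "(\<integral>x. g x \<partial>M) = 1 - e * (1 - measure N B)"
    unfolding g_def using int_l1 El1 by (simp add: M.prob_space algebra_simps)
  have "(\<integral>x. (g x)\<^sup>2 \<partial>M) = (1 - e)\<^sup>2 + 2 * (1 - e) * e * measure N B +
      e\<^sup>2 * (\<integral>x. (l x)\<^sup>2 * indicator B x \<partial>M)"
    unfolding g2 using int_l1 int_l2 El1 by (simp add: M.prob_space)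
  also have "\<dots> \<le> (1 - e)\<^sup>2 + 2 * (1 - e) * e * 1 + e\<^sup>2 * K"
    using e El2 by (intro add_mono mult_left_mono) auto
  \<comment> \<open>The first two terms add up to \<open>1 - e\<^sup>2\<close>.\<close>
  also have "\<dots> \<le> 1 + e\<^sup>2 * K"
    by (simp add: power2_eq_square algebra_simps)
  finally have Eg2: "(\<integral>x. (g x)\<^sup>2 \<partial>M) \<le> 1 + e\<^sup>2 * K" .
  have "1 - sqrt (1 - 2 * (1 - e * (1 - measure N B)) ^ card I + (1 + e\<^sup>2 * K) ^ card I)
      \<le> 1 - sqrt (1 - 2 * (\<integral>x. g x \<partial>M) ^ card I + (\<integral>x. (g x)\<^sup>2 \<partial>M) ^ card I)"
    using Eg2 by (simp add: Eg power_mono)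
  also have "\<dots> \<le> measure (PiM I (\<lambda>_. M)) A + measure Q (space Q - A)"
    unfolding Q_def mix
    by (rule PiM_error_sum_ge) (use assms g0 gf int_g2 pf in auto)
  finally show "1 - sqrt (1 - 2 * (1 - e * (1 - measure N B)) ^ card I + (1 + e\<^sup>2 * K) ^ card I)
      \<le> measure (PiM I (\<lambda>_. M)) A + measure Q (space Q - A)" .
qed

section \<open>Counts of p-values and the higher criticism statistic\<close>

lemma real_card_eq_sum_indicator:
  assumes "finite I"
  shows "real (card {i \<in> I. x i \<in> B}) = (\<Sum>i\<in>I. indicator B (x i))"
  using assms by (simp add: indicator_def sum.If_cases Int_def)

lemma borel_measurable_count:
  assumes "finite I" and [measurable]: "B \<in> sets M"
  shows "(\<lambda>x. real (card {i \<in> I. x i \<in> B})) \<in> borel_measurable (PiM I (\<lambda>_. M))"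
  unfolding real_card_eq_sum_indicator[OF assms(1)] by measurable

text \<open>Chebyshev's inequality. Independence removes the mixed moments of the centred indicators
  and leaves one variance per coordinate; it equals \<open>p - p\<^sup>2\<close>, of which the bound
  \<open>p\<close> is kept.\<close>

lemma PiM_count_deviation:
  fixes M :: "'a measure" and I :: "'i set"
  assumes I: "finite I" and "prob_space M" and B [measurable]: "B \<in> sets M" and c: "0 < c"
  shows "measure (PiM I (\<lambda>_. M)) {x \<in> space (PiM I (\<lambda>_. M)).
      c \<le> \<bar>real (card {i \<in> I. x i \<in> B}) - real (card I) * measure M B\<bar>}
    \<le> real (card I) * measure M B / c\<^sup>2"
proof -
  interpret M: prob_space M by fact
  interpret PM: product_sigma_finite "\<lambda>_. M" ..
  interpret P: prob_space "PiM I (\<lambda>_. M)"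
    by (rule prob_space_PiM[OF M.prob_space_axioms])
  define p where "p = measure M B"
  define Y :: "'a \<Rightarrow> real" where "Y = (\<lambda>x. indicator B x - p)"
  define S where "S = (\<lambda>x. \<Sum>i\<in>I. Y (x i))"
  have Y [measurable]: "Y \<in> borel_measurable M"
    by (simp add: Y_def)
  have intB: "integrable M (indicator B :: _ \<Rightarrow> real)"
    by (simp add: M.emeasure_eq_measure)
  then have int: "integrable M Y" and EY: "(\<integral>x. Y x \<partial>M) = 0"
    by (simp_all add: Y_def M.prob_space p_def)
  have Y2: "Y x * Y x = (1 - 2 * p) * indicator B x + p\<^sup>2" for x
    by (simp add: Y_def indicator_def power2_eq_square algebra_simps)
  have int2: "integrable M (\<lambda>x. Y x * Y x)" and EY2: "(\<integral>x. Y x * Y x \<partial>M) \<le> p"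
    unfolding Y2 using intB by (simp_all add: M.prob_space p_def[symmetric] power2_eq_square algebra_simps)
  have prod: "integrable (PiM I (\<lambda>_. M)) (\<lambda>x. Y (x i) * Y (x j)) \<and>
      (\<integral>x. Y (x i) * Y (x j) \<partial>PiM I (\<lambda>_. M)) = (if i = j then (\<integral>x. Y x * Y x \<partial>M) else 0)"
    if ij: "i \<in> I" "j \<in> I" for i j
  proof -
    \<comment> \<open>Both factors are spread over all coordinates, with 1 elsewhere, so that the
      product formula applies; for \<open>i = j\<close> they meet in one coordinate and give the
      square.\<close>
    define f where "f = (\<lambda>k x. (if k = i then Y x else 1) * (if k = j then Y x else 1))"
    have f: "(\<Prod>k\<in>I. f k (x k)) = Y (x i) * Y (x j)" for x
      using I ij by (simp add: f_def prod.distrib prod.delta)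
    have intf: "integrable M (f k)" for k
      using int int2 by (cases "k = i"; cases "k = j") (simp_all add: f_def)
    have "(\<Prod>k\<in>I. \<integral>x. f k x \<partial>M) = (if i = j then (\<integral>x. Y x * Y x \<partial>M) else 0)"
    proof (cases "i = j")
      case True
      then have "(\<Prod>k\<in>I. \<integral>x. f k x \<partial>M) = (\<Prod>k\<in>I. if k = i then (\<integral>x. Y x * Y x \<partial>M) else 1)"
        by (intro prod.cong) (auto simp: f_def M.prob_space)
      then show ?thesis
        using True I ij by (simp add: prod.delta)
    next
      case False
      then have "(\<integral>x. f i x \<partial>M) = 0"
        by (simp add: f_def EY)
      then show ?thesis
        using False I ij by (auto intro!: prod_zero)
    qed
    then show ?thesis
      using PM.product_integrable_prod[OF I, of f] PM.product_integral_prod[OF I, of f] intf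
      unfolding f by simp
  qed
  have S2: "(S x)\<^sup>2 = (\<Sum>i\<in>I. \<Sum>j\<in>I. Y (x i) * Y (x j))" for x
    by (simp add: S_def power2_eq_square sum_product)
  have intS2: "integrable (PiM I (\<lambda>_. M)) (\<lambda>x. (S x)\<^sup>2)"
    unfolding S2 by (intro Bochner_Integration.integrable_sum) (use prod in auto)
  have "(\<integral>x. (S x)\<^sup>2 \<partial>PiM I (\<lambda>_. M)) =
      (\<Sum>i\<in>I. \<Sum>j\<in>I. (\<integral>x. Y (x i) * Y (x j) \<partial>PiM I (\<lambda>_. M)))"
    unfolding S2
  proof (subst Bochner_Integration.integral_sum)
    show "integrable (PiM I (\<lambda>_. M)) (\<lambda>x. \<Sum>j\<in>I. Y (x i) * Y (x j))" if "i \<in> I" for i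
      using prod[OF that] by (intro Bochner_Integration.integrable_sum) auto
    show "(\<Sum>i\<in>I. \<integral>x. (\<Sum>j\<in>I. Y (x i) * Y (x j)) \<partial>PiM I (\<lambda>_. M)) =
        (\<Sum>i\<in>I. \<Sum>j\<in>I. (\<integral>x. Y (x i) * Y (x j) \<partial>PiM I (\<lambda>_. M)))"
      using prod by (intro sum.cong refl Bochner_Integration.integral_sum) auto
  qed
  also have "\<dots> = (\<Sum>i\<in>I. \<Sum>j\<in>I. if i = j then (\<integral>x. Y x * Y x \<partial>M) else 0)"
    using prod by (intro sum.cong) auto
  also have "\<dots> = real (card I) * (\<integral>x. Y x * Y x \<partial>M)"
    using I by simp
  finally have ES2: "(\<integral>x. (S x)\<^sup>2 \<partial>PiM I (\<lambda>_. M)) \<le> real (card I) * p"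
    using EY2 by (simp add: mult_left_mono)
  have S: "real (card {i \<in> I. x i \<in> B}) - real (card I) * p = S x" for x :: "'i \<Rightarrow> 'a"
    by (simp add: real_card_eq_sum_indicator[OF I] S_def Y_def sum_subtractf)
  have "P.prob {x \<in> space (PiM I (\<lambda>_. M)). c \<le> \<bar>S x\<bar>} \<le> (\<integral>x. (S x)\<^sup>2 \<partial>PiM I (\<lambda>_. M)) / c\<^sup>2"
  proof (rule P.second_moment_method)
    show "S \<in> borel_measurable (PiM I (\<lambda>_. M))"
      unfolding S_def by measurable
  qed fact+
  also have "\<dots> \<le> real (card I) * p / c\<^sup>2"
    using ES2 by (intro divide_right_mono) auto
  finally show ?thesis
    unfolding p_def[symmetric] S .
qed

text \<open>In a sorted list the entries that are at most \<open>t\<close> form an initial segment;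
  with indices from 0, position \<open>k\<close> lies in it exactly when its length exceeds
  \<open>k\<close>.\<close>

lemma sorted_nth_le_iff:
  fixes ys :: "'a :: linorder list"
  shows "sorted ys \<Longrightarrow> k < length ys \<Longrightarrow> ys ! k \<le> t \<longleftrightarrow> k < length (filter (\<lambda>y. y \<le> t) ys)"
proof (induction ys arbitrary: k)
  case (Cons a ys)
  show ?case
  proof (cases "a \<le> t")
    case True
    then show ?thesis
      using Cons by (cases k) auto
  next
    case False
    then have gt: "\<forall>y\<in>set (a # ys). \<not> y \<le> t"
      using Cons.prems(1) by auto
    then have "\<not> (a # ys) ! k \<le> t"
      using nth_mem[OF Cons.prems(2)] by blast
    moreover have "filter (\<lambda>y. y \<le> t) (a # ys) = []"
      using gt by (simp add: filter_False)
    ultimately show ?thesis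
      by simp
  qed
qed simp

text \<open>Events about order statistics become events about counts; the measurability of the
  higher criticism statistic and its lower bound both rest on this.\<close>

lemma sorted_p_value_le_iff:
  assumes "1 \<le> i" "i \<le> n"
  shows "sorted_p_value n X i \<le> t \<longleftrightarrow> i \<le> card {j \<in> {1..n}. p_value (X j) \<le> t}"
proof -
  let ?xs = "map (\<lambda>j. p_value (X j)) [1..<Suc n]"
  have "length (filter (\<lambda>y. y \<le> t) (sort ?xs)) = length (filter (\<lambda>y. y \<le> t) ?xs)"
    unfolding filter_sort by simp
  also have "\<dots> = card ({j. p_value (X j) \<le> t} \<inter> {1..n})"
    unfolding length_filter_map
    by (subst distinct_length_filter)
       (auto simp: atLeastLessThanSuc_atLeastAtMost comp_def simp del: upt_Suc)
  also have "{j. p_value (X j) \<le> t} \<inter> {1..n} = {j \<in> {1..n}. p_value (X j) \<le> t}"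
    by auto
  finally have len: "length (filter (\<lambda>y. y \<le> t) (sort ?xs)) = card {j \<in> {1..n}. p_value (X j) \<le> t}" .
  have "i - 1 < length (sort ?xs)"
    using assms by (simp del: upt_Suc)
  then have "sorted_p_value n X i \<le> t \<longleftrightarrow> i - 1 < length (filter (\<lambda>y. y \<le> t) (sort ?xs))"
    unfolding sorted_p_value_def by (intro sorted_nth_le_iff) simp
  then show ?thesis
    using assms unfolding len by linarith
qed

section \<open>The law of the p-values under the null\<close>

lemma p_value_eq: "p_value x = (if 0 \<le> x then exp (- x / 2) else 1)"
proof -
  interpret E: prob_space Exp2 by (rule prob_space_Exp2)
  have [simp]: "space Exp2 = UNIV"
    by (simp add: Exp2_def)
  have "distributed Exp2 lborel (\<lambda>x. x) (exponential_density (1 / 2))"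
    by (simp add: distributed_def Exp2_def distr_id2)
  then have gt: "p_value a = exp (- a / 2)" if "0 \<le> a" for a
    using E.exponential_distributedD_gt[of "\<lambda>x. x" "1 / 2" a] that
    by (simp add: p_value_def greaterThan_def)
  have "p_value 0 \<le> p_value x" if "x < 0"
    unfolding p_value_def using that by (intro E.finite_measure_mono) auto
  then show ?thesis
    using gt[of x] gt[of 0] E.prob_le_1 by (auto simp: p_value_def intro!: antisym)
qed

lemma p_value_pos: "0 < p_value x"
  by (simp add: p_value_eq)

lemma p_value_le_iff:
  assumes "0 < t" "t < 1"
  shows "p_value x \<le> t \<longleftrightarrow> - 2 * ln t \<le> x"
proof -
  have "ln t < 0"
    using assms by simp
  moreover have "exp (- x / 2) \<le> t \<longleftrightarrow> - x / 2 \<le> ln t"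
    using ln_le_cancel_iff[of "exp (- x / 2)" t] assms by simp
  moreover have "\<not> - 2 * ln t \<le> x" if "x < 0"
    using that \<open>ln t < 0\<close> by linarith
  ultimately show ?thesis
    using assms by (cases "0 \<le> x") (auto simp: p_value_eq)
qed

text \<open>The probability integral transform: p-values are uniform under the null. The closed
  half-line differs from the open one in \<open>p_value\<close> by a single point, which has mass
  0.\<close>

lemma measure_Exp2_p_value_le:
  assumes "0 < t" "t < 1"
  shows "measure Exp2 {x. p_value x \<le> t} = t"
proof -
  interpret E: prob_space Exp2 by (rule prob_space_Exp2)
  define a where "a = - 2 * ln t"
  have "0 \<le> a"
    using assms by (simp add: a_def)
  have "absolutely_continuous lborel Exp2"
    unfolding Exp2_def by (rule absolutely_continuousI_density) simp
  then have "{a} \<in> null_sets Exp2"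
    unfolding absolutely_continuous_def by (rule subsetD) (simp add: null_sets_def)
  moreover have "{x. p_value x \<le> t} = {a} \<union> {a<..}"
    using assms by (auto simp: p_value_le_iff a_def)
  ultimately have "measure Exp2 {x. p_value x \<le> t} = p_value a"
    unfolding p_value_def by (metis Un_commute greaterThan_borel measure_Un_null_set sets_Exp2)
  then show ?thesis
    using \<open>0 \<le> a\<close> assms by (simp add: p_value_eq) (simp add: a_def)
qed

lemma borel_measurable_p_value [measurable]: "p_value \<in> borel_measurable borel"
  unfolding p_value_eq[abs_def] by measurable

lemma borel_measurable_sorted_p_value:
  assumes "1 \<le> i" "i \<le> n"
  shows "(\<lambda>X. sorted_p_value n X i) \<in> borel_measurable (PiM {1..n} (\<lambda>_. borel))"
proof (subst borel_measurable_iff_le, intro allI)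
  fix t
  have [measurable]: "{x. p_value x \<le> t} \<in> sets borel"
    by measurable
  have "(\<lambda>X. real (card {j \<in> {1..n}. X j \<in> {x. p_value x \<le> t}})) \<in> borel_measurable (PiM {1..n} (\<lambda>_. borel))"
    by (rule borel_measurable_count) auto
  then have "{X \<in> space (PiM {1..n} (\<lambda>_. borel)). real i \<le> real (card {j \<in> {1..n}. X j \<in> {x. p_value x \<le> t}})}
      \<in> sets (PiM {1..n} (\<lambda>_. borel))"
    unfolding borel_measurable_iff_ge by blast
  then show "{X \<in> space (PiM {1..n} (\<lambda>_. borel)). sorted_p_value n X i \<le> t} \<in> sets (PiM {1..n} (\<lambda>_. borel))"
    unfolding sorted_p_value_le_iff[OF assms] of_nat_le_iff mem_Collect_eq .
qed

section \<open>The higher criticism statistic\<close>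

lemma HC_index_le:
  assumes "real i \<le> \<alpha>0 * real n" "\<alpha>0 \<le> 1"
  shows "i \<le> n"
proof -
  have "\<alpha>0 * real n \<le> 1 * real n"
    using assms(2) by (intro mult_right_mono) auto
  then show ?thesis
    using assms(1) by simp
qed

lemma borel_measurable_HC:
  assumes "\<alpha>0 \<le> 1"
  shows "HC \<alpha>0 n \<in> borel_measurable (PiM {1..n} (\<lambda>_. borel))"
proof -
  have "finite {i. 1 \<le> i \<and> real i \<le> \<alpha>0 * real n}"
    by (rule finite_subset[OF subsetI finite_atMost[of n]]) (use HC_index_le[OF _ assms] in blast)
  then show ?thesis
    unfolding HC_def[abs_def]
  proof (rule borel_measurable_Max[where f = "\<lambda>i X. sqrt (real n) * (real i / real n - sorted_p_value n X i) /
        sqrt (sorted_p_value n X i * (1 - sorted_p_value n X i))"])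
    fix i assume "i \<in> {i. 1 \<le> i \<and> real i \<le> \<alpha>0 * real n}"
    then have [measurable]: "(\<lambda>X. sorted_p_value n X i) \<in> borel_measurable (PiM {1..n} (\<lambda>_. borel))"
      using HC_index_le[OF _ assms] by (intro borel_measurable_sorted_p_value) blast+
    show "(\<lambda>X. sqrt (real n) * (real i / real n - sorted_p_value n X i) /
        sqrt (sorted_p_value n X i * (1 - sorted_p_value n X i))) \<in> borel_measurable (PiM {1..n} (\<lambda>_. borel))"
      by measurable
  qed
qed

text \<open>The term of index \<open>N\<close> in the maximum suffices. Its order statistic is at
  most \<open>t\<close>; replacing it by \<open>t\<close> lowers the numerator, and replacing
  \<open>p * (1 - p)\<close> by \<open>t\<close> enlarges the denominator. So the normalised excess
  count at a single threshold is a lower bound.\<close>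

lemma HC_ge:
  fixes X :: "nat \<Rightarrow> real" and n :: nat and t :: real
  defines "N \<equiv> card {j \<in> {1..n}. p_value (X j) \<le> t}"
  assumes "\<alpha>0 \<le> 1" "0 < t" "t < 1" and N: "real n * t < real N" "real N \<le> \<alpha>0 * real n"
  shows "(real N - real n * t) / sqrt (real n * t) \<le> HC \<alpha>0 n X"
proof -
  have "N \<le> card {1..n}"
    unfolding N_def by (intro card_mono) auto
  then have "N \<le> n"
    by simp
  have "0 < N"
  proof (rule ccontr)
    assume "\<not> 0 < N"
    then have "real n * t < 0"
      using N(1) by simp
    then show False
      using \<open>0 < t\<close> by (simp add: mult_less_0_iff)
  qed
  then have "0 < n"
    using \<open>N \<le> n\<close> by simp
  define p where "p = sorted_p_value n X N"
  have "p \<le> t"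
    unfolding p_def using \<open>0 < N\<close> \<open>N \<le> n\<close> by (subst sorted_p_value_le_iff) (auto simp: N_def)
  have "p \<in> set (sort (map (\<lambda>j. p_value (X j)) [1..<Suc n]))"
    unfolding p_def sorted_p_value_def using \<open>0 < N\<close> \<open>N \<le> n\<close> by (intro nth_mem) auto
  then have "0 < p"
    using p_value_pos by auto
  have "real N / real n - p \<ge> (real N - real n * t) / real n"
    using \<open>p \<le> t\<close> \<open>0 < n\<close> by (simp add: field_simps)
  moreover have "t \<le> real N / real n"
    using \<open>0 < n\<close> N(1) by (simp add: field_simps)
  then have "p \<le> real N / real n"
    using \<open>p \<le> t\<close> by linarith
  moreover have "p * (1 - p) \<le> t * 1"
    using \<open>0 < p\<close> \<open>p \<le> t\<close> \<open>t < 1\<close> by (intro mult_mono) auto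
  moreover have "0 < p * (1 - p)"
    using \<open>0 < p\<close> \<open>p \<le> t\<close> \<open>t < 1\<close> by simp
  ultimately have "sqrt (real n) * ((real N - real n * t) / real n) / sqrt t
      \<le> sqrt (real n) * (real N / real n - p) / sqrt (p * (1 - p))"
    using N(1) \<open>0 < n\<close> by (intro frac_le mult_left_mono mult_nonneg_nonneg) auto
  also have "\<dots> \<le> HC \<alpha>0 n X"
    unfolding HC_def p_def
  proof (rule Max_ge)
    have "finite {i. 1 \<le> i \<and> real i \<le> \<alpha>0 * real n}"
      by (rule finite_subset[OF subsetI finite_atMost[of n]]) (use HC_index_le[OF _ \<open>\<alpha>0 \<le> 1\<close>] in blast)
    then show "finite ((\<lambda>i. sqrt (real n) * (real i / real n - sorted_p_value n X i)
                / sqrt (sorted_p_value n X i * (1 - sorted_p_value n X i)))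
          ` {i. 1 \<le> i \<and> real i \<le> \<alpha>0 * real n})"
      by simp
  qed (use N \<open>0 < N\<close> in auto)
  also have "sqrt (real n) * ((real N - real n * t) / real n) / sqrt t = (real N - real n * t) / sqrt (real n * t)"
  proof -
    have "sqrt (real n) * ((real N - real n * t) / real n) / sqrt t =
        (sqrt (real n) / real n) * ((real N - real n * t) / sqrt t)"
      by simp
    also have "sqrt (real n) / real n = inverse (sqrt (real n))"
      by (rule sqrt_divide_self_eq) simp
    finally show ?thesis
      by (simp add: real_sqrt_mult divide_inverse)
  qed
  finally show ?thesis .
qed

section \<open>Merging below the boundary\<close>

text \<open>The inequality of arithmetic and geometric means linearises \<open>sqrt (T * x)\<close>,
  with equality at the left end \<open>x = T\<close> of the tail. The dominating density thereby
  becomes a decaying exponential, because \<open>sqrt r < 1\<close>, and is integrated in closed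
  form.\<close>

lemma ncchisq2_tail_le:
  assumes r: "0 \<le> r" "r < 1" and T: "0 < T"
  shows "measure (ncchisq2 (r * T)) {T<..} \<le> exp (- (T / 2) * (1 - sqrt r)\<^sup>2) / (1 - sqrt r)"
proof -
  interpret Q: prob_space "ncchisq2 (r * T)" by (rule prob_space_ncchisq2)
  define k where "k = 1 - sqrt r"
  have k: "0 < k"
    using r by (simp add: k_def real_sqrt_lt_1_iff)
  define c where "c = sqrt r * T / 2 - r * T / 2"
  define f where "f = (\<lambda>x. exp (c - k / 2 * x) / 2)"
  have le: "exponential_density (1 / 2) x * ncchisq2_bound (r * T) x \<le> f x" if "T \<le> x" for x
  proof -
    have "sqrt (T * x) \<le> (T + x) / 2"
      using that T by (intro arith_geo_mean_sqrt) auto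
    then have "sqrt (r * T * x) \<le> sqrt r * ((T + x) / 2)"
      using r by (simp add: real_sqrt_mult mult.assoc mult_left_mono)
    then have "- x / 2 + (sqrt (r * T * x) - r * T / 2) \<le> c - k / 2 * x"
      by (simp add: c_def k_def field_simps)
    then have "exp (- x / 2) * exp (sqrt (r * T * x) - r * T / 2) \<le> exp (c - k / 2 * x)"
      unfolding exp_add[symmetric] by simp
    then show ?thesis
      using that T by (simp add: exponential_density_def f_def ncchisq2_bound_def)
  qed
  have "ennreal (measure (ncchisq2 (r * T)) {T<..}) \<le> emeasure (density Exp2 (ncchisq2_bound (r * T))) {T<..}"
    using le_measureD3[OF ncchisq2_le[of "r * T"]] r T by (simp add: Q.emeasure_eq_measure[symmetric])
  also have "\<dots> = (\<integral>\<^sup>+x. ennreal (exponential_density (1 / 2) x * ncchisq2_bound (r * T) x) * indicator {T<..} x \<partial>lborel)"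
    unfolding Exp2_def
    by (simp add: emeasure_density nn_integral_density ennreal_mult ncchisq2_bound_def exponential_density_nonneg mult.assoc)
  also have "\<dots> \<le> (\<integral>\<^sup>+x. ennreal (f x) * indicator {T..} x \<partial>lborel)"
    by (intro nn_integral_mono) (auto simp: indicator_def intro!: ennreal_leI le)
  also have "\<dots> = ennreal (0 - (- exp (c - k / 2 * T) / k))"
  proof (rule nn_integral_FTC_atLeast)
    show "((\<lambda>x. - exp (c - k / 2 * x) / k) \<longlongrightarrow> 0) at_top"
      using k by real_asymp
    show "((\<lambda>x. - exp (c - k / 2 * x) / k) has_real_derivative f x) (at x)" if "T \<le> x" for x
      using k by (auto intro!: derivative_eq_intros simp: f_def)
  qed (auto simp: f_def)
  also have "0 - (- exp (c - k / 2 * T) / k) = exp (- (T / 2) * k\<^sup>2) / k"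
    using r by (simp add: c_def k_def power2_eq_square field_simps)
  finally show ?thesis
    using k by (simp add: k_def)
qed

text \<open>The supremum of \<open>2 sqrt (r x) - r - x / 2\<close> over \<open>0 \<le> x \<le> 1\<close>; without the truncation at 1 it would be
  \<open>r\<close> for every \<open>r\<close>.\<close>

definition second_moment_exponent :: "real \<Rightarrow> real" where
  "second_moment_exponent r = (if r \<le> 1 / 4 then r else r - (2 * sqrt r - 1)\<^sup>2 / 2)"

text \<open>With \<open>y = sqrt x\<close> and \<open>z = sqrt (r * T)\<close> the exponent is
  \<open>z\<^sup>2 - (2 * z - y)\<^sup>2 / 2\<close>. Its free maximum at
  \<open>x = 4 * r * T\<close> lies in the window only if \<open>r \<le> 1 / 4\<close>; otherwise
  the maximum is at \<open>x = T\<close>. The factor \<open>T\<close> is the length of the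
  window.\<close>

lemma truncated_second_moment_le:
  assumes r: "0 \<le> r" and T: "0 < T"
  shows "(\<integral>\<^sup>+x. ennreal ((ncchisq2_bound (r * T) x)\<^sup>2) * indicator {..T} x \<partial>Exp2)
    \<le> ennreal (exp (second_moment_exponent r * T) * T / 2)"
proof -
  define c where "c = exp (second_moment_exponent r * T) / 2"
  have le: "exponential_density (1 / 2) x * (ncchisq2_bound (r * T) x)\<^sup>2 \<le> c" if x: "0 \<le> x" "x \<le> T" for x
  proof -
    define y where "y = sqrt x"
    define z where "z = sqrt r * sqrt T"
    have yz: "y\<^sup>2 = x" "z\<^sup>2 = r * T" "sqrt (r * T * x) = y * z"
      using x r T by (simp_all add: y_def z_def power_mult_distrib real_sqrt_mult)
    have "- y\<^sup>2 / 2 + 2 * (y * z) - z\<^sup>2 \<le> second_moment_exponent r * T"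
    proof (cases "r \<le> 1 / 4")
      case True
      have "0 \<le> (y - 2 * z)\<^sup>2"
        by simp
      then have "- y\<^sup>2 / 2 + 2 * (y * z) - z\<^sup>2 \<le> z\<^sup>2"
        by (simp add: power2_eq_square algebra_simps)
      then show ?thesis
        using True by (simp add: second_moment_exponent_def yz)
    next
      case False
      have "1 / 2 \<le> sqrt r"
        using False by (intro real_le_rsqrt) (simp add: power2_eq_square)
      then have "0 \<le> 2 * sqrt r - 1"
        by simp
      then have "0 \<le> (2 * sqrt r - 1) * sqrt T"
        using T by simp
      moreover have "(2 * sqrt r - 1) * sqrt T \<le> 2 * z - y"
        using x by (simp add: z_def y_def algebra_simps)
      ultimately have "((2 * sqrt r - 1) * sqrt T)\<^sup>2 \<le> (2 * z - y)\<^sup>2"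
        by (intro power_mono)
      then have "(2 * sqrt r - 1)\<^sup>2 * T \<le> (2 * z - y)\<^sup>2"
        using T by (simp add: power_mult_distrib)
      moreover have "(2 * z - y)\<^sup>2 = 4 * z\<^sup>2 - 4 * (y * z) + y\<^sup>2"
        by (simp add: power2_eq_square algebra_simps)
      ultimately have "- y\<^sup>2 / 2 + 2 * (y * z) - z\<^sup>2 \<le> z\<^sup>2 - (2 * sqrt r - 1)\<^sup>2 * T / 2"
        by linarith
      then show ?thesis
        using False by (simp add: second_moment_exponent_def yz left_diff_distrib)
    qed
    then have "- x / 2 + 2 * (sqrt (r * T * x) - r * T / 2) \<le> second_moment_exponent r * T"
      by (simp add: yz)
    then have "exp (- x / 2) * (exp (sqrt (r * T * x) - r * T / 2))\<^sup>2 \<le> exp (second_moment_exponent r * T)"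
      unfolding exp_double[symmetric] exp_add[symmetric] by simp
    then show ?thesis
      using x by (simp add: exponential_density_def c_def ncchisq2_bound_def)
  qed
  have "(\<integral>\<^sup>+x. ennreal ((ncchisq2_bound (r * T) x)\<^sup>2) * indicator {..T} x \<partial>Exp2) =
      (\<integral>\<^sup>+x. ennreal (exponential_density (1 / 2) x * (ncchisq2_bound (r * T) x)\<^sup>2) * indicator {..T} x \<partial>lborel)"
    unfolding Exp2_def
    by (subst nn_integral_density) (auto simp: ennreal_mult exponential_density_nonneg mult.assoc)
  also have "\<dots> \<le> (\<integral>\<^sup>+x. ennreal c * indicator {0..T} x \<partial>lborel)"
  proof (intro nn_integral_mono)
    fix x
    show "ennreal (exponential_density (1 / 2) x * (ncchisq2_bound (r * T) x)\<^sup>2) * indicator {..T} x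
        \<le> ennreal c * indicator {0..T} x"
    proof (cases "0 \<le> x")
      case True
      then show ?thesis
        by (auto simp: indicator_def intro!: ennreal_leI le)
    qed (simp add: exponential_density_def)
  qed
  also have "\<dots> = ennreal (exp (second_moment_exponent r * T) * T / 2)"
    using T by (simp add: nn_integral_cmult c_def flip: ennreal_mult)
  finally show ?thesis .
qed

text \<open>These are the exponents of \<open>n\<close> in the two error terms: the expected number
  of signals lost by the truncation, and \<open>n\<close> times the excess of the truncated second
  moment.\<close>

lemma below_boundary_exponents:
  assumes "1 / 2 < \<beta>" "\<beta> < 1" "0 < r" "r < 1" "r < rho_Exp \<beta>"
  shows "1 - \<beta> - (1 - sqrt r)\<^sup>2 < 0" and "1 - 2 * \<beta> + 2 * second_moment_exponent r < 0"
proof -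
  define s where "s = sqrt (1 - \<beta>)"
  define w where "w = sqrt r"
  have s: "s\<^sup>2 = 1 - \<beta>" "0 < s" "s < 1" and w: "w\<^sup>2 = r" "0 < w" "w < 1"
    using assms by (auto simp: s_def w_def)
  have ws: "w < 1 - s"
  proof -
    \<comment> \<open>The difference of \<open>(1 - s)\<^sup>2\<close> and
      \<open>\<beta> - 1 / 2\<close> is twice this square, so \<open>w < 1 - s\<close> follows below
      either branch of the boundary.\<close>
    have "0 \<le> (s - 1 / 2)\<^sup>2"
      by simp
    then have "\<beta> - 1 / 2 \<le> (1 - s)\<^sup>2"
      using s(1) by (simp add: power2_eq_square algebra_simps)
    then have "w\<^sup>2 < (1 - s)\<^sup>2"
      using assms(5) by (auto simp: rho_Exp_def w s_def split: if_splits)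
    then show ?thesis
      using s by (intro power2_less_imp_less[of w "1 - s"]) auto
  qed
  then have "s\<^sup>2 < (1 - w)\<^sup>2"
    using s by (intro power_strict_mono) auto
  then show *: "1 - \<beta> - (1 - sqrt r)\<^sup>2 < 0"
    using s(1) by (simp add: w_def)
  show "1 - 2 * \<beta> + 2 * second_moment_exponent r < 0"
  proof (cases "r \<le> 1 / 4")
    case True
    then have "r < \<beta> - 1 / 2"
      using assms(5) by (auto simp: rho_Exp_def split: if_splits)
    then show ?thesis
      using True by (simp add: second_moment_exponent_def)
  next
    case False
    \<comment> \<open>By these expansions the second exponent is exactly twice the first.\<close>
    have "(1 - w)\<^sup>2 = 1 - 2 * w + r" and "(2 * w - 1)\<^sup>2 = 4 * r - 4 * w + 1"
      using w(1) by (simp_all add: power2_eq_square algebra_simps)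
    moreover have "second_moment_exponent r = r - (2 * w - 1)\<^sup>2 / 2"
      using False by (simp add: second_moment_exponent_def w_def)
    ultimately show ?thesis
      using * unfolding w_def[symmetric] by linarith
  qed
qed

text \<open>One sequence \<open>c\<close> serves all tests at once, so that the bound applies to the
  likelihood ratio test and to higher criticism alike.\<close>

lemma merging_lower_bound:
  assumes "1 / 2 < \<beta>" "\<beta> < 1" "0 < r" "r < 1" "r < rho_Exp \<beta>"
  obtains c where "c \<longlonglongrightarrow> 1"
    and "\<forall>\<^sub>F n in sequentially. \<forall>A\<in>sets (H0 n).
      c n \<le> measure (H0 n) A + measure (H1 \<beta> r n) (space (H1 \<beta> r n) - A)"
proof -
  define k where "k = 1 - sqrt r"
  define g where "g = second_moment_exponent r"
  define u where "u = (\<lambda>n. real n powr (1 - \<beta> - k\<^sup>2) / k)"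
  define v where "v = (\<lambda>n. real n powr (1 - 2 * \<beta> + 2 * g) * ln (real n))"
  \<comment> \<open>The radicand is \<open>1 - 2 * (1 - u n) + exp (v n)\<close>, where
    \<open>1 - u n\<close> bounds the mean of the truncated ratio of the sample from below and
    \<open>exp (v n)\<close> bounds its second moment from above.\<close>
  define c where "c = (\<lambda>n. 1 - sqrt (2 * u n + exp (v n) - 1))"
  have k: "0 < k"
    using assms by (simp add: k_def real_sqrt_lt_1_iff)
  have neg: "1 - \<beta> - k\<^sup>2 < 0" "1 - 2 * \<beta> + 2 * g < 0"
    unfolding k_def g_def using below_boundary_exponents[OF assms] by auto
  have "u \<longlonglongrightarrow> 0"
    unfolding u_def using k neg(1) by real_asymp
  have "v \<longlonglongrightarrow> 0"
    unfolding v_def using neg(2) by real_asymp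
  have "c \<longlonglongrightarrow> 1 - sqrt (2 * 0 + exp 0 - 1)"
    unfolding c_def by (intro tendsto_intros) fact+
  then have "c \<longlonglongrightarrow> 1"
    by simp
  moreover have "\<forall>\<^sub>F n in sequentially. \<forall>A\<in>sets (H0 n).
      c n \<le> measure (H0 n) A + measure (H1 \<beta> r n) (space (H1 \<beta> r n) - A)"
    using eventually_ge_at_top[of 2]
  proof eventually_elim
    case (elim n)
    define L where "L = ln (real n)"
    define e where "e = real n powr - \<beta>"
    \<comment> \<open>At the truncation level \<open>2 * L\<close> the p-value equals
      \<open>1 / n\<close>, the scale of the largest null observation; the noncentrality is
      \<open>r\<close> times this level.\<close>
    define K where "K = exp (g * (2 * L)) * (2 * L) / 2"
    have L: "0 < L"
      using elim by (simp add: L_def)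
    have pw: "real n powr a = exp (a * L)" for a
      using elim by (simp add: powr_def L_def)
    have n: "real n = exp L"
      using elim by (simp add: L_def)
    have e: "0 \<le> e" "e \<le> 1"
      using elim assms L by (simp_all add: e_def pw)
    have d: "2 * r * ln (real n) = r * (2 * L)"
      by (simp add: L_def)
    interpret Q: prob_space "ncchisq2 (r * (2 * L))" by (rule prob_space_ncchisq2)
    have space: "space (ncchisq2 (r * (2 * L))) = UNIV"
      by (simp add: ncchisq2_def)
    have "1 - measure (ncchisq2 (r * (2 * L))) {..2 * L} = measure (ncchisq2 (r * (2 * L))) {2 * L<..}"
      using Q.prob_compl[of "{..2 * L}"] by (simp add: space Compl_eq_Diff_UNIV[symmetric])
    also have "\<dots> \<le> exp (- (2 * L / 2) * (1 - sqrt r)\<^sup>2) / (1 - sqrt r)"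
      using assms L by (intro ncchisq2_tail_le) auto
    also have "\<dots> = exp (- L * k\<^sup>2) / k"
      by (simp add: k_def)
    finally have q: "1 - measure (ncchisq2 (r * (2 * L))) {..2 * L} \<le> exp (- L * k\<^sup>2) / k" .
    have "real n * (e * (1 - measure (ncchisq2 (r * (2 * L))) {..2 * L})) \<le> real n * (e * (exp (- L * k\<^sup>2) / k))"
      using q e by (intro mult_left_mono) auto
    also have "\<dots> = u n"
      unfolding u_def e_def pw unfolding n by (simp add: algebra_simps flip: exp_add)
    finally have u: "real n * (e * (1 - measure (ncchisq2 (r * (2 * L))) {..2 * L})) \<le> u n" .
    have "real n * (e\<^sup>2 * K) = v n"
      unfolding v_def e_def K_def pw L_def[symmetric] unfolding n by (simp add: algebra_simps flip: exp_add exp_double)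
    have "(1 + e\<^sup>2 * K) ^ n \<le> exp (e\<^sup>2 * K) ^ n"
      using e L by (intro power_mono exp_ge_add_one_self) (simp add: K_def)
    also have "\<dots> = exp (v n)"
      unfolding \<open>_ = v n\<close>[symmetric] by (rule exp_of_nat_mult[symmetric])
    finally have v: "(1 + e\<^sup>2 * K) ^ n \<le> exp (v n)" .
    have "e * (1 - measure (ncchisq2 (r * (2 * L))) {..2 * L}) \<le> 1 * 1"
      using e by (intro mult_mono) auto
    then have "1 - real n * (e * (1 - measure (ncchisq2 (r * (2 * L))) {..2 * L}))
        \<le> (1 - e * (1 - measure (ncchisq2 (r * (2 * L))) {..2 * L})) ^ n"
      using Bernoulli_inequality[of "- (e * (1 - measure (ncchisq2 (r * (2 * L))) {..2 * L}))" n] by simp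
    with u v have "c n \<le> 1 - sqrt (1 - 2 * (1 - e * (1 - measure (ncchisq2 (r * (2 * L))) {..2 * L})) ^ n + (1 + e\<^sup>2 * K) ^ n)"
      unfolding c_def by simp
    moreover have "1 - sqrt (1 - 2 * (1 - e * (1 - measure (ncchisq2 (r * (2 * L))) {..2 * L})) ^ card {1..n}
        + (1 + e\<^sup>2 * K) ^ card {1..n}) \<le> measure (H0 n) A + measure (H1 \<beta> r n) (space (H1 \<beta> r n) - A)"
      if "A \<in> sets (H0 n)" for A
      unfolding H0_def H1_def d e_def[symmetric]
    proof (rule mixture_error_sum_ge(2))
      show "ncchisq2 (r * (2 * L)) \<le> density Exp2 (ncchisq2_bound (r * (2 * L)))"
        using assms L by (intro ncchisq2_le) auto
      show "(\<integral>\<^sup>+x. ennreal ((ncchisq2_bound (r * (2 * L)) x)\<^sup>2) * indicator {..2 * L} x \<partial>Exp2) \<le> ennreal K"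
        unfolding K_def g_def using assms L by (intro truncated_second_moment_le) auto
    qed (use that L e in \<open>auto simp: H0_def K_def ncchisq2_bound_def prob_space_Exp2 prob_space_ncchisq2\<close>)
    ultimately show ?case
      by (auto intro: order_trans)
  qed
  ultimately show thesis
    by (rule that)
qed

section \<open>Basic properties of the joint laws\<close>

lemma powr_uminus_le_one:
  fixes x b :: real
  assumes "1 \<le> x" "0 \<le> b"
  shows "x powr - b \<le> 1"
  using assms by (simp add: powr_minus ge_one_powr_ge_zero inverse_le_1_iff)

lemma prob_space_H0: "prob_space (H0 n)"
  unfolding H0_def by (intro prob_space_PiM prob_space_Exp2)

lemma prob_space_H1:
  assumes "1 \<le> n" "0 \<le> \<beta>"
  shows "prob_space (H1 \<beta> r n)"
  unfolding H1_def
  using assms by (intro prob_space_PiM prob_space_mixture prob_space_Exp2 prob_space_ncchisq2) (auto intro: powr_uminus_le_one)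

text \<open>Absolute continuity comes from the domination by \<open>ncchisq2_bound\<close>; the
  empty truncation set with \<open>K = 0\<close> makes the moment condition trivial. This is what
  allows \<open>lrt_error_minimal\<close> to be applied.\<close>

lemma absolutely_continuous_H0_H1:
  assumes "1 \<le> n" "0 \<le> \<beta>" "0 \<le> r"
  shows "absolutely_continuous (H0 n) (H1 \<beta> r n)"
proof -
  have e: "real n powr - \<beta> \<le> 1"
    using assms by (intro powr_uminus_le_one) auto
  show ?thesis
    unfolding H0_def H1_def
  proof (rule mixture_error_sum_ge(1))
    show "ncchisq2 (2 * r * ln (real n)) \<le> density Exp2 (ncchisq2_bound (2 * r * ln (real n)))"
      using assms by (intro ncchisq2_le) auto
    show "(\<integral>\<^sup>+x. ennreal ((ncchisq2_bound (2 * r * ln (real n)) x)\<^sup>2) * indicator {} x \<partial>Exp2) \<le> ennreal 0"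
      by simp
  qed (use e in \<open>auto simp: ncchisq2_bound_def prob_space_Exp2 prob_space_ncchisq2\<close>)
qed

section \<open>Power above the boundary\<close>

text \<open>Up to logarithmic factors, \<open>n powr (1 - \<beta> - (q - sqrt r)\<^sup>2)\<close> is the expected number of non-null p-values
  below \<open>n powr - q\<^sup>2\<close>, and \<open>n powr ((1 - q\<^sup>2) / 2)\<close> is the standard deviation of the null count. The witness
  \<open>q = min (2 sqrt r) 1\<close> maximises the ratio.\<close>

lemma detection_exponent:
  assumes "1 / 2 < \<beta>" "\<beta> < 1" "0 < r" "r < 1" "rho_Exp \<beta> < r"
  obtains q where "0 < q" "q \<le> 1" "sqrt r \<le> q" "0 < 1 - \<beta> - (q - sqrt r)\<^sup>2 - (1 - q\<^sup>2) / 2"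
proof -
  define w where "w = sqrt r"
  have w: "w\<^sup>2 = r" "0 < w" "w < 1"
    using assms by (auto simp: w_def)
  show thesis
  proof (cases "r < 1 / 4")
    case True
    have "\<beta> \<le> 3 / 4"
    proof (rule ccontr)
      assume "\<not> \<beta> \<le> 3 / 4"
      then have "sqrt (1 - \<beta>) \<le> 1 / 2"
        by (intro real_le_lsqrt) (auto simp: power2_eq_square)
      then have "(1 / 2)\<^sup>2 \<le> (1 - sqrt (1 - \<beta>))\<^sup>2"
        by (intro power_mono) auto
      then show False
        using \<open>\<not> \<beta> \<le> 3 / 4\<close> True assms(5) by (simp add: rho_Exp_def power2_eq_square)
    qed
    then have "\<beta> - 1 / 2 < r"
      using assms(5) by (simp add: rho_Exp_def)
    have "w < 1 / 2"
      using True w by (intro power2_less_imp_less[of w "1 / 2"]) (auto simp: power2_eq_square)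
    have "(2 * w - w)\<^sup>2 = r" "(2 * w)\<^sup>2 = 4 * r"
      using w by (simp_all add: power2_eq_square)
    then show thesis
      using w \<open>w < 1 / 2\<close> \<open>\<beta> - 1 / 2 < r\<close> by (intro that[of "2 * w"]) (auto simp: w_def[symmetric])
  next
    case False
    define s where "s = sqrt (1 - \<beta>)"
    have s: "s\<^sup>2 = 1 - \<beta>" "0 < s" "s < 1"
      using assms by (auto simp: s_def)
    \<comment> \<open>With \<open>q = 1\<close> the required inequality reads
      \<open>(1 - w)\<^sup>2 < s\<^sup>2\<close>.\<close>
    have "1 - s < w"
    proof (cases "\<beta> < 3 / 4")
      case True
      then have "1 / 2 < s"
        unfolding s_def by (intro real_less_rsqrt) (simp add: power2_eq_square)
      moreover have "1 / 2 \<le> w"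
        using False unfolding w_def by (intro real_le_rsqrt) (simp add: power2_eq_square)
      ultimately show ?thesis
        by simp
    next
      case False
      \<comment> \<open>Both branches of the boundary take the value \<open>1 / 4\<close> at
        \<open>\<beta> = 3 / 4\<close>, where the definition uses the linear one.\<close>
      have "rho_Exp \<beta> = (1 - s)\<^sup>2"
      proof (cases "\<beta> = 3 / 4")
        case True
        then have "s = 1 / 2"
          unfolding s_def by (intro real_sqrt_unique) (auto simp: power2_eq_square)
        then show ?thesis
          unfolding \<open>s = 1 / 2\<close> using True by (simp add: rho_Exp_def power2_eq_square)
      next
        case False
        then show ?thesis
          using \<open>\<not> \<beta> < 3 / 4\<close> by (simp add: rho_Exp_def s_def)
      qed
      then show ?thesis
        using assms(5) w by (intro power2_less_imp_less[of "1 - s" w]) auto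
    qed
    then have "(1 - w)\<^sup>2 < s\<^sup>2"
      using w s by (intro power_strict_mono) auto
    then show thesis
      using w s by (intro that[of 1]) (auto simp: w_def[symmetric])
  qed
qed

text \<open>In the application \<open>W\<^sup>2\<close> is the null mean of the count,
  \<open>S\<close> the mean number of signals counted, \<open>d\<close> the null mass they displace,
  and \<open>l\<close> is \<open>ln n\<close>. The square root term costs at most
  \<open>W * l + S / 2\<close>, and the margin \<open>W * l\<close> on the left and \<open>d\<close>
  cost at most \<open>W * l\<close> each, whence the constant 6. The square of \<open>l\<close>
  ensures \<open>2 * l \<le> sqrt S\<close>.\<close>

lemma signal_dominates_fluctuation:
  fixes W l S d :: real
  assumes W: "1 \<le> W" and l: "1 \<le> l" and S: "6 * W * l\<^sup>2 \<le> S" and d: "0 \<le> d" "d \<le> W" "d \<le> W\<^sup>2 + S"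
  shows "W\<^sup>2 + W * l \<le> (W\<^sup>2 + S - d) - sqrt (W\<^sup>2 + S - d) * l"
proof -
  have l2: "l \<le> l\<^sup>2"
    using l by (simp add: self_le_power)
  have "6 * W * l \<le> 6 * W * l\<^sup>2"
    using l2 W by (intro mult_left_mono) auto
  then have S1: "6 * W * l \<le> S"
    using S by linarith
  have "6 * 1 * l\<^sup>2 \<le> 6 * W * l\<^sup>2"
    using W by (intro mult_right_mono) auto
  then have S2: "4 * l\<^sup>2 \<le> S"
    using S zero_le_power2[of l] by linarith
  have "0 \<le> S"
    using S2 zero_le_power2[of l] by linarith
  have "sqrt (W\<^sup>2 + S - d) \<le> sqrt (W\<^sup>2 + S)"
    using d by simp
  also have "\<dots> \<le> sqrt (W\<^sup>2) + sqrt S"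
    using \<open>0 \<le> S\<close> by (intro sqrt_add_le_add_sqrt) auto
  also have "\<dots> = W + sqrt S"
    using W by simp
  finally have "sqrt (W\<^sup>2 + S - d) * l \<le> (W + sqrt S) * l"
    using l by (intro mult_right_mono) auto
  moreover have "2 * l \<le> sqrt S"
    using S2 by (intro real_le_rsqrt) (simp add: power2_eq_square)
  then have "sqrt S * (2 * l) \<le> sqrt S * sqrt S"
    using \<open>0 \<le> S\<close> by (intro mult_left_mono) auto
  then have "sqrt S * l \<le> S / 2"
    using \<open>0 \<le> S\<close> by simp
  moreover have "W * 1 \<le> W * l"
    using W l by (intro mult_left_mono) auto
  ultimately show ?thesis
    using S1 d by (simp add: algebra_simps)
qed

text \<open>The upper bound on the count keeps the index of the largest p-value below \<open>t\<close> within the range of the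
  maximum defining \<^const>\<open>HC\<close>.\<close>

definition count_test :: "real \<Rightarrow> nat \<Rightarrow> real \<Rightarrow> (nat \<Rightarrow> real) set" where
  "count_test \<alpha>0 n t = {X \<in> space (PiM {1..n} (\<lambda>_. borel)).
     real n * t + sqrt (real n * t) * ln (real n) \<le> real (card {j \<in> {1..n}. X j \<in> {x. p_value x \<le> t}}) \<and>
     real (card {j \<in> {1..n}. X j \<in> {x. p_value x \<le> t}}) \<le> \<alpha>0 * real n}"

lemma p_value_le_sets [measurable, simp]: "{x. p_value x \<le> t} \<in> sets borel"
  by measurable

lemma sets_count_test [measurable]: "count_test \<alpha>0 n t \<in> sets (PiM {1..n} (\<lambda>_. borel))"
proof -
  have [measurable]: "(\<lambda>X. real (card {j \<in> {1..n}. X j \<in> {x. p_value x \<le> t}})) \<in> borel_measurable (PiM {1..n} (\<lambda>_. borel))"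
    by (rule borel_measurable_count) auto
  show ?thesis
    unfolding count_test_def by measurable
qed

lemma sets_H0: "sets (H0 n) = sets (PiM {1..n} (\<lambda>_. borel))"
  unfolding H0_def by (intro sets_PiM_cong) auto

lemma sets_H1: "sets (H1 \<beta> r n) = sets (PiM {1..n} (\<lambda>_. borel))"
  unfolding H1_def by (intro sets_PiM_cong) auto

lemma H0_count_test_le:
  assumes n: "2 \<le> n" and t: "0 < t" "t < 1"
  shows "measure (H0 n) (count_test \<alpha>0 n t) \<le> 1 / (ln (real n))\<^sup>2"
proof -
  interpret P: prob_space "H0 n"
    by (rule prob_space_H0)
  define c where "c = sqrt (real n * t) * ln (real n)"
  have c: "0 < c" "c\<^sup>2 = real n * t * (ln (real n))\<^sup>2"
    using n t by (auto simp: c_def power_mult_distrib)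
  have "measure (H0 n) (count_test \<alpha>0 n t) \<le>
      measure (H0 n) {X \<in> space (H0 n). c \<le> \<bar>real (card {j \<in> {1..n}. X j \<in> {x. p_value x \<le> t}})
        - real (card {1..n}) * measure Exp2 {x. p_value x \<le> t}\<bar>}"
  proof (rule P.finite_measure_mono)
    show "count_test \<alpha>0 n t \<subseteq> {X \<in> space (H0 n). c \<le> \<bar>real (card {j \<in> {1..n}. X j \<in> {x. p_value x \<le> t}})
        - real (card {1..n}) * measure Exp2 {x. p_value x \<le> t}\<bar>}"
      unfolding measure_Exp2_p_value_le[OF t] count_test_def c_def sets_eq_imp_space_eq[OF sets_H0]
      by auto
    have [measurable]: "(\<lambda>X. real (card {j \<in> {1..n}. X j \<in> {x. p_value x \<le> t}})) \<in> borel_measurable (H0 n)"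
      unfolding H0_def by (rule borel_measurable_count) auto
    show "{X \<in> space (H0 n). c \<le> \<bar>real (card {j \<in> {1..n}. X j \<in> {x. p_value x \<le> t}})
        - real (card {1..n}) * measure Exp2 {x. p_value x \<le> t}\<bar>} \<in> sets (H0 n)"
      by measurable
  qed
  also have "\<dots> \<le> real (card {1..n}) * measure Exp2 {x. p_value x \<le> t} / c\<^sup>2"
    unfolding H0_def by (rule PiM_count_deviation) (auto simp: prob_space_Exp2 c)
  also have "\<dots> = 1 / (ln (real n))\<^sup>2"
    using n t unfolding measure_Exp2_p_value_le[OF t] c(2) by simp
  finally show ?thesis .
qed

text \<open>Chebyshev's inequality confines the count to a window of half-width
  \<open>sqrt (n * p) * ln n\<close> around \<open>n * p\<close>; the assumptions
  \<open>lower\<close> and \<open>upper\<close> put this window inside the range that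
  \<open>count_test\<close> asks for.\<close>

lemma H1_count_test_ge:
  fixes \<alpha>0 \<beta> r t p :: real
  assumes n: "2 \<le> n" and \<beta>: "0 \<le> \<beta>"
  defines "p \<equiv> measure (mixture (real n powr - \<beta>) Exp2 (ncchisq2 (2 * r * ln (real n)))) {x. p_value x \<le> t}"
  assumes p: "0 < p"
    and lower: "real n * t + sqrt (real n * t) * ln (real n) \<le> real n * p - sqrt (real n * p) * ln (real n)"
    and upper: "real n * p + sqrt (real n * p) * ln (real n) \<le> \<alpha>0 * real n"
  shows "1 - 1 / (ln (real n))\<^sup>2 \<le> measure (H1 \<beta> r n) (count_test \<alpha>0 n t)"
proof -
  define M where "M = mixture (real n powr - \<beta>) Exp2 (ncchisq2 (2 * r * ln (real n)))"
  have sM [measurable_cong]: "sets M = sets borel"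
    by (simp add: M_def)
  have "real n powr - \<beta> \<le> 1"
    using n \<beta> by (intro powr_uminus_le_one) auto
  then have M: "prob_space M"
    unfolding M_def by (intro prob_space_mixture prob_space_Exp2 prob_space_ncchisq2) auto
  have H1: "H1 \<beta> r n = PiM {1..n} (\<lambda>_. M)"
    by (simp add: H1_def M_def)
  interpret Q: prob_space "H1 \<beta> r n"
    using n \<beta> by (intro prob_space_H1) auto
  define c where "c = sqrt (real n * p) * ln (real n)"
  have c: "0 < c" "c\<^sup>2 = real n * p * (ln (real n))\<^sup>2"
    using n p by (auto simp: c_def power_mult_distrib)
  define D where "D = {X \<in> space (H1 \<beta> r n). c \<le> \<bar>real (card {j \<in> {1..n}. X j \<in> {x. p_value x \<le> t}})
        - real (card {1..n}) * measure M {x. p_value x \<le> t}\<bar>}"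
  have p': "measure M {x. p_value x \<le> t} = p"
    by (simp add: p_def M_def)
  have test: "count_test \<alpha>0 n t \<in> Q.events"
    unfolding sets_H1 by (rule sets_count_test)
  have [measurable]: "(\<lambda>X. real (card {j \<in> {1..n}. X j \<in> {x. p_value x \<le> t}})) \<in> borel_measurable (H1 \<beta> r n)"
    unfolding H1 by (rule borel_measurable_count) (auto simp: sM)
  have D: "D \<in> Q.events"
    unfolding D_def by measurable
  have "Q.prob D \<le> real (card {1..n}) * measure M {x. p_value x \<le> t} / c\<^sup>2"
    unfolding D_def H1 by (rule PiM_count_deviation) (auto simp: M c sM)
  also have "\<dots> = 1 / (ln (real n))\<^sup>2"
    using n p unfolding p' c(2) by simp
  finally have "1 - 1 / (ln (real n))\<^sup>2 \<le> Q.prob (space (H1 \<beta> r n) - D)"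
    using D by (simp add: Q.prob_compl)
  also have "\<dots> \<le> Q.prob (count_test \<alpha>0 n t)"
  proof (rule Q.finite_measure_mono[OF _ test])
    show "space (H1 \<beta> r n) - D \<subseteq> count_test \<alpha>0 n t"
      using lower upper unfolding D_def p' count_test_def sets_eq_imp_space_eq[OF sets_H1]
      by (auto simp: not_le abs_less_iff c_def)
  qed
  finally show ?thesis .
qed

text \<open>With \<open>L = ln n\<close>, the right-hand side bounds the mean number of counted
  signals from below. Expanding the square gives \<open>k\<^sup>2 * L\<close> plus a term of order
  \<open>sqrt L\<close>, so the positive gap between the exponents absorbs both this term and the
  factor \<open>L\<^sup>2\<close>.\<close>

lemma eventually_signal_ge:
  assumes k: "0 \<le> k" and pos: "0 < 1 - \<beta> - k\<^sup>2 - (1 - q\<^sup>2) / 2"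
  shows "\<forall>\<^sub>F L in at_top. 6 * exp ((1 - q\<^sup>2) / 2 * L) * L\<^sup>2
    \<le> exp ((1 - \<beta>) * L) * (exp (- (k * sqrt (2 * L) + 1)\<^sup>2 / 2) / sqrt (2 * pi))"
proof -
  define \<eta> where "\<eta> = 1 - \<beta> - k\<^sup>2 - (1 - q\<^sup>2) / 2"
  have "\<eta> > 0"
    using pos by (simp add: \<eta>_def)
  define C where "C = 6 * sqrt (2 * pi)"
  have "C > 0"
    by (simp add: C_def)
  have "((\<lambda>L. C * L\<^sup>2 / exp (\<eta> * L - k * sqrt (2 * L) - 1 / 2)) \<longlongrightarrow> 0) at_top"
  proof (cases "k = 0")
    case True
    then show ?thesis
      using \<open>\<eta> > 0\<close> \<open>C > 0\<close> by simp real_asymp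
  next
    case False
    then have "k > 0"
      using k by simp
    then show ?thesis
      using \<open>\<eta> > 0\<close> \<open>C > 0\<close> by real_asymp
  qed
  then have "\<forall>\<^sub>F L in at_top. C * L\<^sup>2 / exp (\<eta> * L - k * sqrt (2 * L) - 1 / 2) < 1"
    by (rule order_tendstoD) simp
  then show ?thesis
    using eventually_ge_at_top[of 0]
  proof eventually_elim
    case (elim L)
    have "(k * sqrt (2 * L) + 1)\<^sup>2 = 2 * k\<^sup>2 * L + 2 * k * sqrt (2 * L) + 1"
      using elim by (simp add: power2_sum power_mult_distrib)
    then have eq: "(1 - q\<^sup>2) / 2 * L + (\<eta> * L - k * sqrt (2 * L) - 1 / 2) =
        (1 - \<beta>) * L + (- (k * sqrt (2 * L) + 1)\<^sup>2 / 2)"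
      by (simp add: \<eta>_def algebra_simps add_divide_distrib diff_divide_distrib)
    have "C * L\<^sup>2 \<le> exp (\<eta> * L - k * sqrt (2 * L) - 1 / 2)"
      using elim(1) by (simp add: divide_less_eq)
    then have "exp ((1 - q\<^sup>2) / 2 * L) * (C * L\<^sup>2) \<le>
        exp ((1 - q\<^sup>2) / 2 * L) * exp (\<eta> * L - k * sqrt (2 * L) - 1 / 2)"
      by (intro mult_left_mono) auto
    also have "\<dots> = exp ((1 - \<beta>) * L) * exp (- (k * sqrt (2 * L) + 1)\<^sup>2 / 2)"
      unfolding exp_add[symmetric] eq ..
    finally show ?case
      by (simp add: C_def field_simps)
  qed
qed

text \<open>The mean count stays below \<open>\<alpha>0 * n\<close> because \<open>p\<close> tends
  to 0, and it clears the null fluctuations by \<open>eventually_signal_ge\<close> and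
  \<open>signal_dominates_fluctuation\<close>.\<close>

lemma powerful_count_test:
  assumes "1 / 2 < \<beta>" "\<beta> < 1" "0 < r" "r < 1" "rho_Exp \<beta> < r" "0 < \<alpha>0"
  obtains t where "\<And>n. 2 \<le> n \<Longrightarrow> 0 < t n \<and> t n < 1"
    and "(\<lambda>n. measure (H1 \<beta> r n) (count_test \<alpha>0 n (t n))) \<longlonglongrightarrow> 1"
proof -
  obtain q where q: "0 < q" "q \<le> 1" "sqrt r \<le> q" "0 < 1 - \<beta> - (q - sqrt r)\<^sup>2 - (1 - q\<^sup>2) / 2"
    using detection_exponent[OF assms(1-5)] by blast
  define k where "k = q - sqrt r"
  \<comment> \<open>A p-value below this threshold means an observation of at least
    \<open>2 * q\<^sup>2 * ln n\<close>, the square of \<open>b\<close> below.\<close>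
  define t where "t = (\<lambda>n::nat. real n powr - (q\<^sup>2))"
  have "\<forall>\<^sub>F n in sequentially. 6 * exp ((1 - q\<^sup>2) / 2 * ln (real n)) * (ln (real n))\<^sup>2
    \<le> exp ((1 - \<beta>) * ln (real n)) * (exp (- (k * sqrt (2 * ln (real n)) + 1)\<^sup>2 / 2) / sqrt (2 * pi))"
    by (rule eventually_compose_filterlim[OF eventually_signal_ge, of k \<beta> q])
       (use q in \<open>auto simp: k_def intro!: filterlim_compose[OF ln_at_top] filterlim_real_sequentially\<close>)
  moreover have "\<forall>\<^sub>F n in sequentially. real n powr - (q\<^sup>2) + real n powr - \<beta> + ln (real n) / sqrt (real n) < \<alpha>0"
  proof (rule order_tendstoD(2))
    show "(\<lambda>n. real n powr - (q\<^sup>2) + real n powr - \<beta> + ln (real n) / sqrt (real n)) \<longlonglongrightarrow> 0"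
    proof -
      have lim: "(\<lambda>n. real n powr - c) \<longlonglongrightarrow> 0" if "0 < c" for c
        using that by real_asymp
      have "(\<lambda>n. ln (real n) / sqrt (real n)) \<longlonglongrightarrow> 0"
        by real_asymp
      then have "(\<lambda>n. real n powr - (q\<^sup>2) + real n powr - \<beta> + ln (real n) / sqrt (real n)) \<longlonglongrightarrow> 0 + 0 + 0"
        using q assms(1) by (intro tendsto_add lim) auto
      then show ?thesis
        by simp
    qed
  qed fact
  ultimately have "\<forall>\<^sub>F n in sequentially. 1 - 1 / (ln (real n))\<^sup>2 \<le> measure (H1 \<beta> r n) (count_test \<alpha>0 n (t n))"
    using eventually_ge_at_top[of 3]
  proof eventually_elim
    case (elim n)
    define L where "L = ln (real n)"
    define e where "e = real n powr - \<beta>"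
    define d where "d = 2 * r * ln (real n)"
    define B where "B = {x. p_value x \<le> t n}"
    interpret Q: prob_space "ncchisq2 d" by (rule prob_space_ncchisq2)
    interpret E: prob_space Exp2 by (rule prob_space_Exp2)
    have "exp 1 \<le> real n"
      using elim(3) by (intro order.trans[OF exp_le]) simp
    then have L: "1 \<le> L"
      unfolding L_def using elim(3) by (subst ln_ge_iff) auto
    have pw: "real n powr a = exp (a * L)" for a
      using elim by (simp add: powr_def L_def)
    have n: "real n = exp L"
      using elim by (simp add: L_def)
    have t: "0 < t n" "t n < 1"
      using L q by (auto simp: t_def pw)
    have e: "0 < e" "e \<le> 1"
      using L assms by (auto simp: e_def pw)
    have "0 \<le> d"
      using L assms by (simp add: d_def flip: L_def)
    have sets_B [measurable]: "B \<in> sets borel"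
      unfolding B_def by measurable
    define b where "b = q * sqrt (2 * L)"
    have sqrt_d: "b - sqrt d = k * sqrt (2 * L)"
      by (simp add: b_def d_def k_def L_def real_sqrt_mult algebra_simps)
    have "0 \<le> k * sqrt (2 * L)"
      using L q by (simp add: k_def)
    have "B = {b\<^sup>2..}"
      unfolding B_def p_value_le_iff[OF t] using L
      by (auto simp: t_def pw b_def power_mult_distrib)
    then have QB: "exp (- (k * sqrt (2 * L) + 1)\<^sup>2 / 2) / sqrt (2 * pi) \<le> measure (ncchisq2 d) B"
      using ncchisq2_tail_ge[of d b] \<open>0 \<le> d\<close> sqrt_d \<open>0 \<le> k * sqrt (2 * L)\<close> by simp
    define p where "p = measure (mixture e Exp2 (ncchisq2 d)) B"
    have p: "p = (1 - e) * t n + e * measure (ncchisq2 d) B"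
    proof -
      have "prob_space (mixture e Exp2 (ncchisq2 d))"
        using e by (intro prob_space_mixture prob_space_Exp2 prob_space_ncchisq2) auto
      then interpret M: prob_space "mixture e Exp2 (ncchisq2 d)" .
      have "ennreal p = ennreal (1 - e) * ennreal (measure Exp2 B) + ennreal e * ennreal (measure (ncchisq2 d) B)"
        unfolding p_def M.emeasure_eq_measure[symmetric] E.emeasure_eq_measure[symmetric] Q.emeasure_eq_measure[symmetric]
        by (rule emeasure_mixture) auto
      also have "\<dots> = ennreal ((1 - e) * measure Exp2 B + e * measure (ncchisq2 d) B)"
        using e by (simp add: ennreal_mult ennreal_plus)
      finally have "p = (1 - e) * measure Exp2 B + e * measure (ncchisq2 d) B"
        using e by (subst (asm) ennreal_inj) (auto simp: p_def)
      then show ?thesis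
        using measure_Exp2_p_value_le[OF t] by (simp add: B_def)
    qed
    define W where "W = exp ((1 - q\<^sup>2) / 2 * L)"
    have W2: "W\<^sup>2 = real n * t n"
      unfolding W_def t_def pw unfolding n by (simp add: algebra_simps diff_divide_distrib flip: exp_double exp_add)
    have "q\<^sup>2 \<le> 1"
      using q by (simp add: power_le_one)
    then have "1 \<le> W"
      using L by (simp add: W_def)
    have W: "sqrt (real n * t n) = W"
      using \<open>1 \<le> W\<close> by (simp flip: W2)
    define S where "S = real n * e * measure (ncchisq2 d) B"
    have ne: "real n * e = exp ((1 - \<beta>) * L)"
      unfolding e_def pw unfolding n by (simp add: algebra_simps flip: exp_add)
    have S: "6 * W * L\<^sup>2 \<le> S"
      using elim(1) mult_left_mono[OF QB, of "real n * e"] e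
      unfolding L_def[symmetric] W_def[symmetric] ne[symmetric] S_def by simp
    \<comment> \<open>This is the part of the null mean \<open>W\<^sup>2\<close> taken away by the
      weight \<open>1 - e\<close>. Since \<open>\<beta> > 1 / 2\<close>, \<open>e * W\<close> is at
      most 1, and the loss is at most \<open>W\<close>.\<close>
    define \<delta> where "\<delta> = e * W\<^sup>2"
    have np: "real n * p = W\<^sup>2 + S - \<delta>"
      unfolding p W2 S_def \<delta>_def by (simp add: algebra_simps)
    have "e * W \<le> 1"
    proof -
      have "0 \<le> q\<^sup>2 * L" "0 \<le> (\<beta> - 1 / 2) * L"
        using L assms by auto
      then have "- \<beta> * L + (1 - q\<^sup>2) / 2 * L \<le> 0"
        by (simp add: algebra_simps diff_divide_distrib)
      then show ?thesis
        unfolding e_def pw W_def exp_add[symmetric] by simp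
    qed
    then have \<delta>: "0 \<le> \<delta>" "\<delta> \<le> W"
      using e \<open>1 \<le> W\<close> mult_right_mono[of "e * W" 1 W] by (auto simp: \<delta>_def power2_eq_square)
    have "0 \<le> S"
      using e by (simp add: S_def)
    have "e * W\<^sup>2 \<le> 1 * W\<^sup>2"
      using e by (intro mult_right_mono) auto
    then have "\<delta> \<le> W\<^sup>2 + S"
      using \<open>0 \<le> S\<close> by (simp add: \<delta>_def)
    have "0 < p"
    proof -
      have "0 < 6 * W * L\<^sup>2"
        using L \<open>1 \<le> W\<close> by simp
      then have "0 < S"
        using S by linarith
      then have "0 < e * measure (ncchisq2 d) B"
        using n by (simp add: S_def zero_less_mult_iff)
      then show ?thesis
        unfolding p using e t by (intro add_nonneg_pos) auto
    qed
    have lower: "real n * t n + sqrt (real n * t n) * L \<le> real n * p - sqrt (real n * p) * L"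
      using signal_dominates_fluctuation[OF \<open>1 \<le> W\<close> L S \<delta> \<open>\<delta> \<le> W\<^sup>2 + S\<close>]
      unfolding W np unfolding W2[symmetric] .
    have "p \<le> 1"
      unfolding p_def
      by (intro prob_space.prob_le_1 prob_space_mixture prob_space_Exp2 prob_space_ncchisq2) (use e in auto)
    have "p \<le> 1 * t n + e * 1"
      unfolding p using e t by (intro add_mono mult_mono) auto
    moreover have "sqrt (real n * p) * L \<le> sqrt (real n * 1) * L"
      using L \<open>p \<le> 1\<close> by (intro mult_right_mono real_sqrt_le_mono mult_left_mono) auto
    moreover have "sqrt (real n) * L = real n * (L / sqrt (real n))"
      using elim(3) real_div_sqrt[of "real n"] by (simp add: field_simps)
    ultimately have "real n * p + sqrt (real n * p) * L \<le> real n * (t n + e) + real n * (L / sqrt (real n))"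
      by (intro add_mono mult_left_mono) auto
    also have "\<dots> = real n * (t n + e + L / sqrt (real n))"
      by (simp add: algebra_simps)
    also have "\<dots> \<le> real n * \<alpha>0"
      using elim(2) by (intro mult_left_mono) (auto simp: t_def e_def L_def)
    finally have upper: "real n * p + sqrt (real n * p) * L \<le> \<alpha>0 * real n"
      by (simp add: mult.commute)
    show ?case
      using elim(3) assms \<open>0 < p\<close> lower upper
      by (intro H1_count_test_ge) (auto simp: p_def L_def e_def d_def B_def)
  qed
  moreover have "\<forall>\<^sub>F n in sequentially. measure (H1 \<beta> r n) (count_test \<alpha>0 n (t n)) \<le> 1"
    using eventually_ge_at_top[of 1]
  proof eventually_elim
    case (elim n)
    then show ?case
      using assms by (intro prob_space.prob_le_1 prob_space_H1) auto
  qed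
  moreover have "(\<lambda>n. 1 - 1 / (ln (real n))\<^sup>2) \<longlonglongrightarrow> 1"
    by real_asymp
  ultimately have "(\<lambda>n. measure (H1 \<beta> r n) (count_test \<alpha>0 n (t n))) \<longlonglongrightarrow> 1"
    by (rule tendsto_sandwich[OF _ _ _ tendsto_const])
  moreover have "0 < t n \<and> t n < 1" if "2 \<le> n" for n
    using that q by (simp add: t_def powr_minus inverse_less_1_iff)
  ultimately show thesis
    using that by blast
qed

lemma H0_count_test_tendsto_0:
  assumes "\<And>n. 2 \<le> n \<Longrightarrow> 0 < t n \<and> t n < 1"
  shows "(\<lambda>n. measure (H0 n) (count_test \<alpha>0 n (t n))) \<longlonglongrightarrow> 0"
proof (rule tendsto_sandwich[OF _ _ tendsto_const])
  show "\<forall>\<^sub>F n in sequentially. measure (H0 n) (count_test \<alpha>0 n (t n)) \<le> 1 / (ln (real n))\<^sup>2"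
    using eventually_ge_at_top[of 2]
  proof eventually_elim
    case (elim n)
    then show ?case
      using assms[OF elim] by (intro H0_count_test_le) auto
  qed
  show "(\<lambda>n. 1 / (ln (real n))\<^sup>2) \<longlonglongrightarrow> 0"
    by real_asymp
qed simp

section \<open>The boundary of the likelihood ratio test\<close>

lemma space_H1: "space (H1 \<beta> r n) = space (H0 n)"
  by (rule sets_eq_imp_space_eq) (simp only: sets_H0 sets_H1)

lemma lrt_error_le:
  assumes "1 \<le> n" "0 \<le> \<beta>" "0 \<le> r" "A \<in> sets (H0 n)"
  shows "lrt_error (H0 n) (H1 \<beta> r n) \<le> measure (H0 n) A + measure (H1 \<beta> r n) (space (H1 \<beta> r n) - A)"
  by (rule lrt_error_minimal)
     (use assms in \<open>simp_all add: prob_space_H0 prob_space_H1 absolutely_continuous_H0_H1 sets_H0 sets_H1\<close>)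

text \<open>The lower bound valid for all tests covers the likelihood ratio test; from above, its
  error is compared with that of the test that never rejects.\<close>

lemma merge_below_boundary:
  assumes "1 / 2 < \<beta>" "\<beta> < 1" "0 < r" "r < 1" "r < rho_Exp \<beta>"
  shows "merge_asymptotically H0 (H1 \<beta> r)"
proof -
  obtain c where c: "c \<longlonglongrightarrow> 1"
    and le: "\<forall>\<^sub>F n in sequentially. \<forall>A\<in>sets (H0 n).
      c n \<le> measure (H0 n) A + measure (H1 \<beta> r n) (space (H1 \<beta> r n) - A)"
    using merging_lower_bound[OF assms] by blast
  have "\<forall>\<^sub>F n in sequentially. c n \<le> lrt_error (H0 n) (H1 \<beta> r n)"
    using le
  proof eventually_elim
    case (elim n)
    define A where "A = {x \<in> space (H0 n). RN_deriv (H0 n) (H1 \<beta> r n) x > 1}"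
    have "A \<in> sets (H0 n)"
      unfolding A_def by measurable
    then have "c n \<le> measure (H0 n) A + measure (H1 \<beta> r n) (space (H1 \<beta> r n) - A)"
      using elim by blast
    moreover have "space (H1 \<beta> r n) - A = {x \<in> space (H1 \<beta> r n). RN_deriv (H0 n) (H1 \<beta> r n) x \<le> 1}"
      by (auto simp: A_def space_H1)
    ultimately show ?case
      unfolding lrt_error_def A_def[symmetric] by simp
  qed
  moreover have "\<forall>\<^sub>F n in sequentially. lrt_error (H0 n) (H1 \<beta> r n) \<le> 1"
    using eventually_ge_at_top[of 1]
  proof eventually_elim
    case (elim n)
    then show ?case
      using lrt_error_le[of n \<beta> r "{}"] assms prob_space.prob_space[OF prob_space_H1, of n \<beta> r] by simp
  qed
  ultimately show ?thesis
    unfolding merge_asymptotically_def by (rule tendsto_sandwich[OF _ _ c tendsto_const])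
qed

text \<open>The likelihood ratio test has the least sum of errors, hence does at least as well as
  the counting test. Taking 1 for \<open>\<alpha>0\<close> lets the count range up to
  \<open>n\<close>.\<close>

lemma separate_above_boundary:
  assumes "1 / 2 < \<beta>" "\<beta> < 1" "0 < r" "r < 1" "rho_Exp \<beta> < r"
  shows "separate_asymptotically H0 (H1 \<beta> r)"
proof -
  obtain t where t: "\<And>n. 2 \<le> n \<Longrightarrow> 0 < t n \<and> t n < 1"
    and power: "(\<lambda>n. measure (H1 \<beta> r n) (count_test 1 n (t n))) \<longlonglongrightarrow> 1"
    using powerful_count_test[OF assms zero_less_one] by blast
  have lim: "(\<lambda>n. measure (H0 n) (count_test 1 n (t n)) + (1 - measure (H1 \<beta> r n) (count_test 1 n (t n)))) \<longlonglongrightarrow> 0 + (1 - 1)"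
    by (rule tendsto_add[OF H0_count_test_tendsto_0[OF t] tendsto_diff[OF tendsto_const power]])
  have upper: "\<forall>\<^sub>F n in sequentially. lrt_error (H0 n) (H1 \<beta> r n) \<le>
      measure (H0 n) (count_test 1 n (t n)) + (1 - measure (H1 \<beta> r n) (count_test 1 n (t n)))"
    using eventually_ge_at_top[of 1]
  proof eventually_elim
    case (elim n)
    have "count_test 1 n (t n) \<in> sets (H0 n)" "count_test 1 n (t n) \<in> sets (H1 \<beta> r n)"
      unfolding sets_H0 sets_H1 by (rule sets_count_test)+
    then show ?case
      using lrt_error_le[of n \<beta> r "count_test 1 n (t n)"] elim assms
        prob_space.prob_compl[OF prob_space_H1, of n \<beta> "count_test 1 n (t n)" r] by simp
  qed
  have "\<forall>\<^sub>F n in sequentially. 0 \<le> lrt_error (H0 n) (H1 \<beta> r n)"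
    by (simp add: lrt_error_def)
  from tendsto_sandwich[OF this upper tendsto_const] lim show ?thesis
    unfolding separate_asymptotically_def by simp
qed

section \<open>The boundary of the higher criticism test\<close>

lemma HC_reject_events:
  assumes "\<alpha>0 \<le> 1" "sets P = sets (PiM {1..n} (\<lambda>_. borel))"
  shows "{X \<in> space P. HC \<alpha>0 n X > s} \<in> sets P"
proof -
  have [measurable]: "HC \<alpha>0 n \<in> borel_measurable P"
    using borel_measurable_HC[OF assms(1)] measurable_cong_sets[OF assms(2) refl] by blast
  show ?thesis
    by measurable
qed

text \<open>The critical value is of order \<open>sqrt (ln (ln n))\<close>, far below the margin
  \<open>ln n\<close> built into \<open>count_test\<close>.\<close>

lemma eventually_HC_critical_value_lt_ln:
  assumes "tends_to_0_slowly_enough h \<alpha>"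
  shows "\<forall>\<^sub>F n in sequentially. h n (\<alpha> n) < ln (real n)"
proof -
  have "(\<lambda>n. h n (\<alpha> n)) \<sim>[sequentially] (\<lambda>n. sqrt (2 * ln (ln (real n))))"
    using assms by (simp add: tends_to_0_slowly_enough_def)
  then have "(\<lambda>n. h n (\<alpha> n)) \<in> O(\<lambda>n. sqrt (2 * ln (ln (real n))))"
    by (rule asymp_equiv_imp_bigo)
  also have "(\<lambda>n. sqrt (2 * ln (ln (real n)))) \<in> o(\<lambda>n. ln (real n))"
    by real_asymp
  finally have "\<forall>\<^sub>F n in sequentially. norm (h n (\<alpha> n)) \<le> (1 / 2) * norm (ln (real n))"
    by (rule landau_o.smallD) simp
  then show ?thesis
    using eventually_ge_at_top[of 2]
  proof eventually_elim
    case (elim n)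
    then have "0 < ln (real n)"
      by simp
    then show ?case
      using elim(1) unfolding real_norm_def by linarith
  qed
qed

text \<open>Eventually \<open>count_test\<close> is contained in the rejection region: on it
  \<open>HC_ge\<close> bounds the statistic below by \<open>ln n\<close>, which exceeds the critical
  value.\<close>

lemma HC_power_above_boundary:
  assumes "1 / 2 < \<beta>" "\<beta> < 1" "0 < r" "r < 1" "rho_Exp \<beta> < r" "0 < \<alpha>0" "\<alpha>0 < 1"
    and slow: "tends_to_0_slowly_enough h \<alpha>"
  shows "(\<lambda>n. HC_reject_prob \<alpha>0 n (H1 \<beta> r n) (h n (\<alpha> n))) \<longlonglongrightarrow> 1"
proof -
  obtain t where t: "\<And>n. 2 \<le> n \<Longrightarrow> 0 < t n \<and> t n < 1"
    and power: "(\<lambda>n. measure (H1 \<beta> r n) (count_test \<alpha>0 n (t n))) \<longlonglongrightarrow> 1"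
    using powerful_count_test[OF assms(1-6)] by blast
  have "\<forall>\<^sub>F n in sequentially. measure (H1 \<beta> r n) (count_test \<alpha>0 n (t n)) \<le>
      HC_reject_prob \<alpha>0 n (H1 \<beta> r n) (h n (\<alpha> n))"
    using eventually_HC_critical_value_lt_ln[OF slow] eventually_ge_at_top[of 2]
  proof eventually_elim
    case (elim n)
    interpret Q: prob_space "H1 \<beta> r n"
      using elim assms by (intro prob_space_H1) auto
    have tn: "0 < t n" "t n < 1"
      using t elim by auto
    show ?case
      unfolding HC_reject_prob_def
    proof (rule Q.finite_measure_mono)
      show "{X \<in> space (H1 \<beta> r n). HC \<alpha>0 n X > h n (\<alpha> n)} \<in> Q.events"
        using assms by (intro HC_reject_events sets_H1) auto
      show "count_test \<alpha>0 n (t n) \<subseteq> {X \<in> space (H1 \<beta> r n). HC \<alpha>0 n X > h n (\<alpha> n)}"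
      proof
        fix X assume X: "X \<in> count_test \<alpha>0 n (t n)"
        define N where "N = card {j \<in> {1..n}. p_value (X j) \<le> t n}"
        have N: "real n * t n + sqrt (real n * t n) * ln (real n) \<le> real N" "real N \<le> \<alpha>0 * real n"
          using X by (auto simp: count_test_def N_def)
        have "0 < sqrt (real n * t n)" "0 < ln (real n)"
          using elim tn by auto
        then have "ln (real n) \<le> (real N - real n * t n) / sqrt (real n * t n)"
          using N(1) by (simp add: pos_le_divide_eq mult.commute)
        \<comment> \<open>Not a link of the chain of inequalities: the positive margin makes the
          count strictly larger than \<open>n * t n\<close>, as \<open>HC_ge\<close>
          requires.\<close>
        also have "0 < sqrt (real n * t n) * ln (real n)"
          using \<open>0 < sqrt (real n * t n)\<close> \<open>0 < ln (real n)\<close> by (rule mult_pos_pos)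
        then have "(real N - real n * t n) / sqrt (real n * t n) \<le> HC \<alpha>0 n X"
          unfolding N_def using assms tn N by (intro HC_ge) (auto simp: N_def)
        finally have "h n (\<alpha> n) < HC \<alpha>0 n X"
          using elim(1) by linarith
        moreover have "X \<in> space (H1 \<beta> r n)"
          using X sets_eq_imp_space_eq[OF sets_H1] by (simp add: count_test_def)
        ultimately show "X \<in> {X \<in> space (H1 \<beta> r n). HC \<alpha>0 n X > h n (\<alpha> n)}"
          by simp
      qed
    qed
  qed
  moreover have "\<forall>\<^sub>F n in sequentially. HC_reject_prob \<alpha>0 n (H1 \<beta> r n) (h n (\<alpha> n)) \<le> 1"
    using eventually_ge_at_top[of 1]
  proof eventually_elim
    case (elim n)
    then show ?case
      unfolding HC_reject_prob_def using assms by (intro prob_space.prob_le_1 prob_space_H1) auto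
  qed
  ultimately show ?thesis
    by (rule tendsto_sandwich[OF _ _ power tendsto_const])
qed

text \<open>The bound for all tests applies to the rejection region, so the power is at most the
  level plus \<open>1 - c n\<close>, and both tend to 0.\<close>

lemma HC_no_power_below_boundary:
  assumes "1 / 2 < \<beta>" "\<beta> < 1" "0 < r" "r < 1" "r < rho_Exp \<beta>" "0 < \<alpha>0" "\<alpha>0 < 1"
    and crit: "HC_critical_values \<alpha>0 h" and \<alpha>: "\<And>n. 0 < \<alpha> n \<and> \<alpha> n < 1" "\<alpha> \<longlonglongrightarrow> 0"
  shows "(\<lambda>n. HC_reject_prob \<alpha>0 n (H1 \<beta> r n) (h n (\<alpha> n))) \<longlonglongrightarrow> 0"
proof -
  obtain c where c: "c \<longlonglongrightarrow> 1"
    and le: "\<forall>\<^sub>F n in sequentially. \<forall>A\<in>sets (H0 n).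
      c n \<le> measure (H0 n) A + measure (H1 \<beta> r n) (space (H1 \<beta> r n) - A)"
    using merging_lower_bound[OF assms(1-5)] by blast
  \<comment> \<open>For such \<open>n\<close> the maximum in \<open>HC\<close> has a nonempty range,
    which is where \<open>HC_critical_values\<close> controls the level.\<close>
  have "\<forall>\<^sub>F n in sequentially. 1 / \<alpha>0 \<le> real n"
    by real_asymp
  then have upper: "\<forall>\<^sub>F n in sequentially. HC_reject_prob \<alpha>0 n (H1 \<beta> r n) (h n (\<alpha> n)) \<le> \<alpha> n + (1 - c n)"
    using le eventually_ge_at_top[of 1]
  proof eventually_elim
    case (elim n)
    interpret Q: prob_space "H1 \<beta> r n"
      using elim assms by (intro prob_space_H1) auto
    define A where "A = {X \<in> space (H0 n). HC \<alpha>0 n X > h n (\<alpha> n)}"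
    have A: "A \<in> sets (H0 n)"
      unfolding A_def using assms by (intro HC_reject_events sets_H0) auto
    then have "A \<in> Q.events"
      by (simp add: sets_H0 sets_H1)
    have "1 \<le> \<alpha>0 * real n"
      using elim(1) assms(6) by (simp add: pos_divide_le_eq mult.commute)
    then have "measure (H0 n) A \<le> \<alpha> n"
      using crit \<alpha>(1)[of n] unfolding HC_critical_values_def HC_reject_prob_def A_def by blast
    moreover have "c n \<le> measure (H0 n) A + (1 - measure (H1 \<beta> r n) A)"
      using bspec[OF elim(2) A] Q.prob_compl[OF \<open>A \<in> Q.events\<close>] by simp
    moreover have "HC_reject_prob \<alpha>0 n (H1 \<beta> r n) (h n (\<alpha> n)) = measure (H1 \<beta> r n) A"
      by (simp add: HC_reject_prob_def A_def space_H1)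
    ultimately show ?case
      by linarith
  qed
  have lim: "(\<lambda>n. \<alpha> n + (1 - c n)) \<longlonglongrightarrow> 0 + (1 - 1)"
    by (rule tendsto_add[OF \<alpha>(2) tendsto_diff[OF tendsto_const c]])
  have "\<forall>\<^sub>F n in sequentially. 0 \<le> HC_reject_prob \<alpha>0 n (H1 \<beta> r n) (h n (\<alpha> n))"
    by (simp add: HC_reject_prob_def)
  from tendsto_sandwich[OF this upper tendsto_const] lim show ?thesis
    by simp
qed

theorem theorem1p7:
  fixes \<alpha>0 \<beta> r :: real
  assumes "0 < \<alpha>0" and "\<alpha>0 < 1"
    and "1 / 2 < \<beta>" and "\<beta> < 1"
    and "0 < r" and "r < 1"
  shows
    "(r < rho_Exp \<beta> \<longrightarrow> merge_asymptotically H0 (H1 \<beta> r)) \<and>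
     (r > rho_Exp \<beta> \<longrightarrow> separate_asymptotically H0 (H1 \<beta> r)) \<and>
     (\<forall>h \<alpha>. HC_critical_values \<alpha>0 h \<and> (\<forall>n. 0 < \<alpha> n \<and> \<alpha> n < 1) \<and> tends_to_0_slowly_enough h \<alpha> \<longrightarrow>
        (r > rho_Exp \<beta> \<longrightarrow> (\<lambda>n. HC_reject_prob \<alpha>0 n (H1 \<beta> r n) (h n (\<alpha> n))) \<longlonglongrightarrow> 1) \<and>
        (r < rho_Exp \<beta> \<longrightarrow> (\<lambda>n. HC_reject_prob \<alpha>0 n (H1 \<beta> r n) (h n (\<alpha> n))) \<longlonglongrightarrow> 0))"
proof (intro conjI allI impI)
  show "merge_asymptotically H0 (H1 \<beta> r)" if "r < rho_Exp \<beta>"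
    using assms that by (intro merge_below_boundary)
  show "separate_asymptotically H0 (H1 \<beta> r)" if "r > rho_Exp \<beta>"
    using assms that by (intro separate_above_boundary)
  fix h \<alpha>
  assume *: "HC_critical_values \<alpha>0 h \<and> (\<forall>n. 0 < \<alpha> n \<and> \<alpha> n < 1) \<and> tends_to_0_slowly_enough h \<alpha>"
  show "(\<lambda>n. HC_reject_prob \<alpha>0 n (H1 \<beta> r n) (h n (\<alpha> n))) \<longlonglongrightarrow> 1" if "r > rho_Exp \<beta>"
    using assms that * by (intro HC_power_above_boundary) simp_all
  show "(\<lambda>n. HC_reject_prob \<alpha>0 n (H1 \<beta> r n) (h n (\<alpha> n))) \<longlonglongrightarrow> 0" if "r < rho_Exp \<beta>"
    using assms that * by (intro HC_no_power_below_boundary) (simp_all add: tends_to_0_slowly_enough_def)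
qed

end
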